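(* Let $\mathbf{A}$ be a unital separable $\mathrm{C}^*$-algebra and let $\mathbf{A}^\#$ be a computable presentation of $\mathbf{A}$ that is computably unital. Let $a\in\mathbf{A}$ be normal and a computable point of $\mathbf{A}^\#$. Let $\Phi : C(\sigma(a)) \to C^*(1_{\mathbf{A}}, a)$ be the continuous functional calculus map. Then: (1) $\Phi$ is a computable $*$-isomorphism from the standard presentation of $C(\sigma(a))$ to the standard presentation of $C^*(1_{\mathbf{A}}, a)$. (2) The standard presentation of $C(\sigma(a))$ is computable. (3) $\Phi$ is a computable map from the standard presentation of $C(\sigma(a))$ to $\mathbf{A}^\#$.
   Context: A presentation $\mathbf{A}^\#$ of a (separable) $\mathrm{C}^*$-algebra $\mathbf{A}$ is $\mathbf{A}$ together with a finite or infinite sequence $(a_n)$ of elements of $\mathbf{A}$, called special points, that generate a dense $*$-subalgebra. The generated points of $\mathbf{A}^\#$ are the elements $p(a_0,\dots,a_m)$ with $p$ a rational $*$-polynomial (a noncommutative polynomial in $x_0,\dots,x_m,x_0^*,\dots,x_m^*$ with coefficients in $\mathbb{Q}(i)$ and no constant term); a code of a generated point is a natural-number code of such a $p$. $\mathbf{A}^\#$ is computable if from a code of a generated point $\rho$ and $k\in\mathbb{N}$ one can compute a rational $q$ with $|\,\|\rho\|-q\,|<2^{-k}$. A point $x$ is a computable point of $\mathbf{A}^\#$ if there is an algorithm which from $k$ computes a code of a generated point $\rho$ with $\|x-\rho\|<2^{-k}$. $\mathbf{A}^\#$ is computably unital if $1_{\mathbf{A}}$ is a computable point of $\mathbf{A}^\#$.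 A name of $x$ is a sequence of (codes of) generated points $(\rho_k)_k$ with $\|x-\rho_k\|<2^{-k}$; a map between presented structures is computable if there is an algorithm (oracle machine) converting any name of an input $x$ into a name of its image. A computable $*$-isomorphism is a $*$-isomorphism that is computable and whose inverse is computable. For a normal $a$ in unital $\mathbf{A}$, $C^*(1_{\mathbf{A}},a)$ is the $\mathrm{C}^*$-subalgebra generated by $1_{\mathbf{A}}$ and $a$, and its standard presentation has special points $1_{\mathbf{A}}$ and $a$. For compact $K\subseteq\mathbb{C}$, the standard presentation of $C(K)$ has as special points the constant function $1$ and the identity function $z:K\to\mathbb{C}$. The continuous functional calculus map is the unique $*$-homomorphism $\Phi:C(\sigma(a))\to\mathbf{A}$ with $\Phi(1)=1_{\mathbf{A}}$ and $\Phi(z)=a$; it is a $*$-isomorphism onto $C^*(1_{\mathbf{A}},a)$. *)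

theory Defs
  imports
    "HOL-Analysis.Analysis"
    "HOL-Library.Function_Algebras"
    "HOL-Library.Nat_Bijection"
begin

section \<open>C*-algebras\<close>

text \<open>
  The purely algebraic operations are separated from the norm, so that they are also available,
  pointwise, on the type \<^typ>\<open>complex \<Rightarrow> complex\<close>, which carries \<open>C(K)\<close> below but has no norm.
\<close>

class complex_star_algebra = ring +
  fixes scaleC :: "complex \<Rightarrow> 'a \<Rightarrow> 'a"  (infixr \<open>*\<^sub>C\<close> 75)
    and star :: "'a \<Rightarrow> 'a"
  assumes scaleC_add_right: "c *\<^sub>C (x + y) = c *\<^sub>C x + c *\<^sub>C y"
    and scaleC_add_left: "(c + d) *\<^sub>C x = c *\<^sub>C x + d *\<^sub>C x"
    and scaleC_scaleC: "c *\<^sub>C d *\<^sub>C x = (c * d) *\<^sub>C x"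
    and scaleC_one: "1 *\<^sub>C x = x"
    and mult_scaleC_left: "(c *\<^sub>C x) * y = c *\<^sub>C (x * y)"
    and mult_scaleC_right: "x * (c *\<^sub>C y) = c *\<^sub>C (x * y)"
    and star_add: "star (x + y) = star x + star y"
    and star_scaleC: "star (c *\<^sub>C x) = cnj c *\<^sub>C star x"
    and star_mult: "star (x * y) = star y * star x"
    and star_star: "star (star x) = x"

class cstar_algebra = complex_star_algebra + real_normed_algebra + banach +
  assumes scaleR_scaleC: "r *\<^sub>R x = complex_of_real r *\<^sub>C x"
    and norm_scaleC: "norm (c *\<^sub>C x) = cmod c * norm x"
    and cstar_identity: "norm (star x * x) = (norm x)\<^sup>2"

text \<open>As \<open>1 \<noteq> 0\<close> is not required, the zero algebra is unital.\<close>

class unital_cstar_algebra = cstar_algebra + monoid_mult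

instantiation complex :: unital_cstar_algebra
begin
definition scaleC_complex :: "complex \<Rightarrow> complex \<Rightarrow> complex" where "scaleC_complex = (*)"
definition star_complex :: "complex \<Rightarrow> complex" where "star_complex = cnj"
instance
  by standard (auto simp: scaleC_complex_def star_complex_def algebra_simps norm_mult
      scaleR_conv_of_real power2_eq_square)
end

instantiation "fun" :: (type, complex_star_algebra) complex_star_algebra
begin
definition scaleC_fun :: "complex \<Rightarrow> ('a \<Rightarrow> 'b) \<Rightarrow> 'a \<Rightarrow> 'b" where
  "scaleC_fun c f = (\<lambda>x. c *\<^sub>C f x)"
definition star_fun :: "('a \<Rightarrow> 'b) \<Rightarrow> 'a \<Rightarrow> 'b" where
  "star_fun f = (\<lambda>x. star (f x))"
instance
  by standard (auto simp: fun_eq_iff scaleC_fun_def star_fun_def scaleC_add_right scaleC_add_left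
      scaleC_scaleC scaleC_one mult_scaleC_left mult_scaleC_right star_add star_scaleC star_mult
      star_star)
end

definition star_subalgebra :: "'a::complex_star_algebra set \<Rightarrow> bool" where
  "star_subalgebra S \<longleftrightarrow> 0 \<in> S \<and> (\<forall>x\<in>S. \<forall>y\<in>S. x + y \<in> S \<and> x * y \<in> S) \<and>
     (\<forall>c. \<forall>x\<in>S. c *\<^sub>C x \<in> S) \<and> (\<forall>x\<in>S. star x \<in> S)"

definition cstar_generated :: "'a::cstar_algebra set \<Rightarrow> 'a set" where
  "cstar_generated X = (\<lambda>S. star_subalgebra S \<and> closed S) hull X"

definition star_hom ::
  "'a::complex_star_algebra set \<Rightarrow> 'b::complex_star_algebra set \<Rightarrow> ('a \<Rightarrow> 'b) \<Rightarrow> bool" where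
  "star_hom S T F \<longleftrightarrow> F \<in> S \<rightarrow> T \<and>
     (\<forall>x\<in>S. \<forall>y\<in>S. F (x + y) = F x + F y \<and> F (x * y) = F x * F y) \<and>
     (\<forall>c. \<forall>x\<in>S. F (c *\<^sub>C x) = c *\<^sub>C F x) \<and> (\<forall>x\<in>S. F (star x) = star (F x))"

definition star_iso ::
  "'a::complex_star_algebra set \<Rightarrow> 'b::complex_star_algebra set \<Rightarrow> ('a \<Rightarrow> 'b) \<Rightarrow> bool" where
  "star_iso S T F \<longleftrightarrow> star_hom S T F \<and> bij_betw F S T"

definition normal :: "'a::complex_star_algebra \<Rightarrow> bool" where
  "normal a \<longleftrightarrow> star a * a = a * star a"

definition spectrum :: "'a::unital_cstar_algebra \<Rightarrow> complex set" where
  "spectrum a = {l. \<not> (\<exists>b. b * (l *\<^sub>C 1 - a) = 1 \<and> (l *\<^sub>C 1 - a) * b = 1)}"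


section \<open>The algebra of continuous functions on a compact subset of the plane\<close>

text \<open>
  A function on \<open>K\<close> is represented by its extension by zero to the whole plane. The unit of
  \<open>C(K)\<close> is therefore the indicator function of \<open>K\<close> and not \<^term>\<open>1 :: complex \<Rightarrow> complex\<close>.
\<close>

definition cont_funs :: "complex set \<Rightarrow> (complex \<Rightarrow> complex) set" where
  "cont_funs K = {f. continuous_on K f \<and> (\<forall>z. z \<notin> K \<longrightarrow> f z = 0)}"

definition const_one_on :: "complex set \<Rightarrow> complex \<Rightarrow> complex" where
  "const_one_on K = (\<lambda>z. if z \<in> K then 1 else 0)"

definition identity_on :: "complex set \<Rightarrow> complex \<Rightarrow> complex" where
  "identity_on K = (\<lambda>z. if z \<in> K then z else 0)"

text \<open>Inserting \<open>0\<close> only matters for empty \<open>K\<close>, where the supremum would be unspecified.\<close>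

definition sup_norm :: "complex set \<Rightarrow> (complex \<Rightarrow> complex) \<Rightarrow> real" where
  "sup_norm K f = Sup (insert 0 ((\<lambda>z. cmod (f z)) ` K))"

text \<open>
  The defining property of the continuous functional calculus; values of \<open>\<Phi>\<close> outside
  \<^term>\<open>cont_funs (spectrum a)\<close> are irrelevant.
\<close>

definition continuous_functional_calculus ::
  "'a::unital_cstar_algebra \<Rightarrow> ((complex \<Rightarrow> complex) \<Rightarrow> 'a) \<Rightarrow> bool" where
  "continuous_functional_calculus a \<Phi> \<longleftrightarrow>
     star_hom (cont_funs (spectrum a)) UNIV \<Phi> \<and>
     \<Phi> (const_one_on (spectrum a)) = 1 \<and>
     \<Phi> (identity_on (spectrum a)) = a"


section \<open>Oracle computability\<close>

text \<open>
  Partial recursive functions relative to an oracle, after Kleene: \<open>oeval orc e xs y\<close> means that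
  program \<open>e\<close> with oracle \<open>orc\<close> halts on the arguments \<open>xs\<close> with output \<open>y\<close>.
\<close>

datatype oprog =
    Zero
  | Succ
  | Proj nat
  | Query
  | Comp oprog "oprog list"
  | PrimRec oprog oprog
  | Mu oprog

inductive oeval :: "(nat \<Rightarrow> nat) \<Rightarrow> oprog \<Rightarrow> nat list \<Rightarrow> nat \<Rightarrow> bool" for orc where
  oeval_Zero: "oeval orc Zero xs 0"
| oeval_Succ: "oeval orc Succ [x] (Suc x)"
| oeval_Proj: "i < length xs \<Longrightarrow> oeval orc (Proj i) xs (xs ! i)"
| oeval_Query: "oeval orc Query [x] (orc x)"
| oeval_Comp:
    "length ys = length gs \<Longrightarrow> (\<And>i. i < length gs \<Longrightarrow> oeval orc (gs ! i) xs (ys ! i)) \<Longrightarrow>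
     oeval orc f ys z \<Longrightarrow> oeval orc (Comp f gs) xs z"
| oeval_PrimRec_0: "oeval orc f xs y \<Longrightarrow> oeval orc (PrimRec f g) (0 # xs) y"
| oeval_PrimRec_Suc:
    "oeval orc (PrimRec f g) (n # xs) r \<Longrightarrow> oeval orc g (n # r # xs) y \<Longrightarrow>
     oeval orc (PrimRec f g) (Suc n # xs) y"
| oeval_Mu:
    "oeval orc f (n # xs) 0 \<Longrightarrow> (\<And>m. m < n \<Longrightarrow> \<exists>y. oeval orc f (m # xs) (Suc y)) \<Longrightarrow>
     oeval orc (Mu f) xs n"

inductive_cases oeval_ZeroE: "oeval orc Zero xs y"
inductive_cases oeval_SuccE: "oeval orc Succ xs y"
inductive_cases oeval_ProjE: "oeval orc (Proj i) xs y"
inductive_cases oeval_QueryE: "oeval orc Query xs y"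
inductive_cases oeval_CompE: "oeval orc (Comp f gs) xs y"
inductive_cases oeval_PrimRec_0E: "oeval orc (PrimRec f g) (0 # xs) y"
inductive_cases oeval_PrimRec_SucE: "oeval orc (PrimRec f g) (Suc n # xs) y"
inductive_cases oeval_MuE: "oeval orc (Mu f) xs y"

lemma oeval_deterministic: "oeval orc e xs y \<Longrightarrow> oeval orc e xs y' \<Longrightarrow> y = y'"
proof (induction arbitrary: y' rule: oeval.induct)
  case (oeval_Zero xs)
  then show ?case by (blast elim: oeval_ZeroE)
next
  case (oeval_Succ x)
  then show ?case by (blast elim: oeval_SuccE)
next
  case (oeval_Proj i xs)
  from oeval_Proj.prems show ?case by (blast elim: oeval_ProjE)
next
  case (oeval_Query x)
  then show ?case by (blast elim: oeval_QueryE)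
next
  case (oeval_Comp ys gs xs f z)
  from oeval_Comp.prems obtain ys' where
    ys': "length ys' = length gs" "\<And>i. i < length gs \<Longrightarrow> oeval orc (gs ! i) xs (ys' ! i)"
      "oeval orc f ys' y'"
    by (rule oeval_CompE) (rule that)
  have "ys = ys'"
    using oeval_Comp.hyps(1) oeval_Comp.IH(1) ys' by (intro nth_equalityI) auto
  then show ?case using oeval_Comp.IH(2) ys'(3) by blast
next
  case (oeval_PrimRec_0 f xs y g)
  from oeval_PrimRec_0.prems show ?case
    by (rule oeval_PrimRec_0E) (rule oeval_PrimRec_0.IH)
next
  case (oeval_PrimRec_Suc f g n xs r y)
  from oeval_PrimRec_Suc.prems obtain r' where
    r': "oeval orc (PrimRec f g) (n # xs) r'" "oeval orc g (n # r' # xs) y'"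
    by (rule oeval_PrimRec_SucE) (rule that)
  from r'(1) have "r = r'" by (rule oeval_PrimRec_Suc.IH(1))
  with r'(2) have "oeval orc g (n # r # xs) y'" by simp
  then show ?case by (rule oeval_PrimRec_Suc.IH(2))
next
  case (oeval_Mu f n xs)
  from oeval_Mu.prems
  have y': "oeval orc f (y' # xs) 0 \<and> (\<forall>m<y'. \<exists>y. oeval orc f (m # xs) (Suc y))"
    by (rule oeval_MuE) blast
  show ?case
  proof (cases n y' rule: linorder_cases)
    case less
    with y' oeval_Mu.IH(1) show ?thesis by blast
  next
    case equal
    then show ?thesis .
  next
    case greater
    with y' oeval_Mu.IH(2) show ?thesis by blast
  qed
qed

text \<open>Computation without an oracle is computation with the constant oracle \<open>0\<close>.\<close>

abbreviation computes :: "oprog \<Rightarrow> nat list \<Rightarrow> nat \<Rightarrow> bool" where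
  "computes \<equiv> oeval (\<lambda>_. 0)"


section \<open>Rational star polynomials and their codes\<close>

text \<open>
  \<open>Var i\<close> and \<open>AdjVar i\<close> stand for the indeterminates \<open>x\<^sub>i\<close> and \<open>x\<^sub>i\<^sup>*\<close>. A monomial is a nonempty
  word, given as its first letter and the remaining ones, so that there is no constant term. A
  polynomial is a finite formal sum of monomials with coefficients in the Gaussian rationals,
  \<open>(p, q)\<close> representing \<open>p + iq\<close>; the terms need not be collected.
\<close>

datatype star_var = Var (var_index: nat) | AdjVar (var_index: nat)

type_synonym star_monomial = "star_var \<times> star_var list"
type_synonym star_poly = "((rat \<times> rat) \<times> star_monomial) list"

primrec var_value :: "(nat \<Rightarrow> 'a::complex_star_algebra) \<Rightarrow> star_var \<Rightarrow> 'a" where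
  "var_value s (Var i) = s i"
| "var_value s (AdjVar i) = star (s i)"

definition monomial_value :: "(nat \<Rightarrow> 'a::complex_star_algebra) \<Rightarrow> star_monomial \<Rightarrow> 'a" where
  "monomial_value s = (\<lambda>(v, vs). foldl (\<lambda>x u. x * var_value s u) (var_value s v) vs)"

definition poly_value :: "(nat \<Rightarrow> 'a::complex_star_algebra) \<Rightarrow> star_poly \<Rightarrow> 'a" where
  "poly_value s P =
     (\<Sum>((p, q), m) \<leftarrow> P. Complex (of_rat p) (of_rat q) *\<^sub>C monomial_value s m)"

definition poly_vars :: "star_poly \<Rightarrow> star_var set" where
  "poly_vars P = (\<Union>(c, v, vs) \<in> set P. insert v (set vs))"

text \<open>Every natural number codes a rational number and a polynomial; codes are not unique.\<close>

definition rat_decode :: "nat \<Rightarrow> rat" where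
  "rat_decode n = (case prod_decode n of (u, v) \<Rightarrow> of_int (int_decode u) / of_nat (Suc v))"

definition var_decode :: "nat \<Rightarrow> star_var" where
  "var_decode n = (case sum_decode n of Inl i \<Rightarrow> Var i | Inr i \<Rightarrow> AdjVar i)"

definition coeff_decode :: "nat \<Rightarrow> rat \<times> rat" where
  "coeff_decode n = map_prod rat_decode rat_decode (prod_decode n)"

definition monomial_decode :: "nat \<Rightarrow> star_monomial" where
  "monomial_decode n = map_prod var_decode (map var_decode \<circ> list_decode) (prod_decode n)"

definition poly_decode :: "nat \<Rightarrow> star_poly" where
  "poly_decode n =
     map (map_prod coeff_decode monomial_decode \<circ> prod_decode) (list_decode n)"

lemma surj_rat_decode: "surj rat_decode"
proof (rule surjI)
  fix q :: rat
  obtain a b where ab: "quotient_of q = (a, b)" by (cases "quotient_of q")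
  then have "q = of_int a / of_int b" "b > 0"
    by (simp_all add: quotient_of_div quotient_of_denom_pos)
  then show "rat_decode (case quotient_of q of (a, b) \<Rightarrow>
      prod_encode (int_encode a, nat b - 1)) = q"
    using ab by (simp add: rat_decode_def)
qed

lemma surj_poly_decode: "surj poly_decode"
proof -
  have prod: "surj prod_decode" by (rule surjI) (rule prod_encode_inverse)
  have list: "surj list_decode" by (rule surjI) (rule list_encode_inverse)
  have surj_map: "surj (map f)" if "surj f" for f :: "'x \<Rightarrow> 'y"
    by (rule surjI [where f = "map (inv f)"]) (simp add: that map_idI surj_f_inv_f)
  have var: "surj var_decode"
  proof (rule surjI)
    show "var_decode (case v of Var i \<Rightarrow> sum_encode (Inl i) | AdjVar i \<Rightarrow> sum_encode (Inr i)) = v"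
      for v by (cases v) (simp_all add: var_decode_def)
  qed
  have coeff: "surj coeff_decode"
    using comp_surj [OF prod map_prod_surj [OF surj_rat_decode surj_rat_decode]]
    by (simp add: coeff_decode_def [abs_def] comp_def)
  have mon: "surj monomial_decode"
    using comp_surj [OF prod map_prod_surj [OF var comp_surj [OF list surj_map [OF var]]]]
    by (simp add: monomial_decode_def [abs_def] comp_def)
  show ?thesis
    using comp_surj [OF list surj_map [OF comp_surj [OF prod map_prod_surj [OF coeff mon]]]]
    by (simp add: poly_decode_def [abs_def] comp_def)
qed


section \<open>Presentations\<close>

text \<open>
  A \<open>presented\<close> C*-algebra: its elements, its norm, and its special points
  \<open>special P i\<close> for \<open>i < num_special P\<close>, finitely or infinitely many of them. The algebraic
  operations are those of the type.
\<close>

record 'a presented =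
  elements :: "'a set"
  norm_of :: "'a \<Rightarrow> real"
  num_special :: enat
  special :: "nat \<Rightarrow> 'a"

definition special_points :: "'a presented \<Rightarrow> 'a set" where
  "special_points P = {special P i | i. enat i < num_special P}"

definition presentation :: "'a::complex_star_algebra presented \<Rightarrow> bool" where
  "presentation P \<longleftrightarrow> star_subalgebra (elements P) \<and> special_points P \<subseteq> elements P \<and>
     (\<forall>x\<in>elements P. \<forall>\<epsilon>>0. \<exists>y \<in> star_subalgebra hull special_points P.
        norm_of P (x - y) < \<epsilon>)"

definition is_code :: "'a::complex_star_algebra presented \<Rightarrow> nat \<Rightarrow> bool" where
  "is_code P c \<longleftrightarrow> (\<forall>v\<in>poly_vars (poly_decode c). enat (var_index v) < num_special P)"

definition generated_point :: "'a::complex_star_algebra presented \<Rightarrow> nat \<Rightarrow> 'a" where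
  "generated_point P c = poly_value (special P) (poly_decode c)"

definition computable_presentation :: "'a::complex_star_algebra presented \<Rightarrow> bool" where
  "computable_presentation P \<longleftrightarrow> presentation P \<and>
     (\<exists>e. \<forall>c k. is_code P c \<longrightarrow>
        (\<exists>r. computes e [c, k] r \<and>
          \<bar>norm_of P (generated_point P c) - of_rat (rat_decode r)\<bar> < 1 / 2 ^ k))"

definition is_name :: "'a::complex_star_algebra presented \<Rightarrow> 'a \<Rightarrow> (nat \<Rightarrow> nat) \<Rightarrow> bool" where
  "is_name P x \<rho> \<longleftrightarrow>
     (\<forall>k. is_code P (\<rho> k) \<and> norm_of P (x - generated_point P (\<rho> k)) < 1 / 2 ^ k)"

definition computable_point :: "'a::complex_star_algebra presented \<Rightarrow> 'a \<Rightarrow> bool" where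
  "computable_point P x \<longleftrightarrow> x \<in> elements P \<and>
     (\<exists>e. \<forall>k. \<exists>c. computes e [k] c \<and> is_code P c \<and>
        norm_of P (x - generated_point P c) < 1 / 2 ^ k)"

definition computable_map ::
  "'a::complex_star_algebra presented \<Rightarrow> 'b::complex_star_algebra presented \<Rightarrow> ('a \<Rightarrow> 'b) \<Rightarrow> bool"
where
  "computable_map P Q F \<longleftrightarrow> presentation P \<and> presentation Q \<and> F \<in> elements P \<rightarrow> elements Q \<and>
     (\<exists>e. \<forall>x\<in>elements P. \<forall>\<rho>. is_name P x \<rho> \<longrightarrow>
        (\<exists>\<sigma>. (\<forall>k. oeval \<rho> e [k] (\<sigma> k)) \<and> is_name Q (F x) \<sigma>))"

definition computable_star_iso ::
  "'a::complex_star_algebra presented \<Rightarrow> 'b::complex_star_algebra presented \<Rightarrow> ('a \<Rightarrow> 'b) \<Rightarrow> bool"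
where
  "computable_star_iso P Q F \<longleftrightarrow> star_iso (elements P) (elements Q) F \<and>
     computable_map P Q F \<and> computable_map Q P (inv_into (elements P) F)"

text \<open>The whole algebra \<^typ>\<open>'a\<close> with special points \<open>s i\<close> for \<open>i < N\<close>.\<close>

definition presented_by :: "enat \<Rightarrow> (nat \<Rightarrow> 'a::cstar_algebra) \<Rightarrow> 'a presented" where
  "presented_by N s = \<lparr>elements = UNIV, norm_of = norm, num_special = N, special = s\<rparr>"

definition computably_unital :: "'a::unital_cstar_algebra presented \<Rightarrow> bool" where
  "computably_unital P \<longleftrightarrow> computable_point P 1"

definition standard_presentation_cstar :: "'a::unital_cstar_algebra \<Rightarrow> 'a presented" where
  "standard_presentation_cstar a =
     \<lparr>elements = cstar_generated {1, a}, norm_of = norm, num_special = 2,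
      special = (\<lambda>i. if i = 0 then 1 else a)\<rparr>"

definition standard_presentation_C :: "complex set \<Rightarrow> (complex \<Rightarrow> complex) presented" where
  "standard_presentation_C K =
     \<lparr>elements = cont_funs K, norm_of = sup_norm K, num_special = 2,
      special = (\<lambda>i. if i = 0 then const_one_on K else identity_on K)\<rparr>"

end

theory Submission
  imports Defs
begin

text \<open>
  Write \<open>K\<close> for the spectrum of \<open>a\<close>. The special points of the standard presentations of \<open>C(K)\<close> and
  of the C*-algebra generated by \<open>1\<close> and \<open>a\<close> correspond to each other under \<open>\<Phi>\<close>, so \<open>\<Phi>\<close> maps the
  generated point with code \<open>c\<close> to the generated point with the same code \<open>c\<close>
  (\<open>map_generated_point\<close>). As \<open>\<Phi>\<close> is isometric (\<open>norm_map\<close>), \<open>f\<close> and \<open>\<Phi> f\<close> have literally the same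
  names, and the program that copies its oracle computes both \<open>\<Phi>\<close> and its inverse.

  That \<open>\<Phi>\<close> is isometric follows from its algebraic properties on all of \<open>C(K)\<close>. A real function
  with values in \<open>[-1, 1]\<close> is the mean of a unitary and its adjoint, so its image has norm at most
  \<open>1\<close>; the C*-identity extends this to \<open>norm (\<Phi> f) \<le> sup_norm K f\<close> (\<open>norm_map_le\<close>). If the inequality
  were strict, \<open>\<Phi>\<close> would annihilate a bump function at a point \<open>w\<close> where \<open>|f|\<close> exceeds \<open>norm (\<Phi> f)\<close>,
  and then \<open>w - a\<close> would be invertible, although \<open>w\<close> is in the spectrum (\<open>cmod_le_norm_map\<close>). The
  range of \<open>\<Phi>\<close> is complete and hence closed, which makes \<open>\<Phi>\<close> an isomorphism onto the generated
  subalgebra (\<open>star_iso\<close>). Density of the polynomials in \<open>z\<close> and its conjugate is the theorem of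
  Stone and Weierstrass.

  The other two claims both reduce to \<open>computable_evaluation\<close>: from a code of a polynomial \<open>p\<close> and
  from \<open>k\<close>, one can compute a code of a generated point of the given presentation at distance less
  than \<open>2\<^sup>-\<^sup>k\<close> from \<open>p(1, a)\<close>. Substitute rational polynomials that approximate \<open>1\<close> and \<open>a\<close> for the
  indeterminates of \<open>p\<close>. The coefficients, the degree and the number of terms of \<open>p\<close> are all bounded
  in terms of the code \<open>c\<close>, so that precision \<open>2\<^sup>-\<^sup>j\<close> suffices for some \<open>j\<close> that is affine in \<open>k\<close> and \<open>c\<close>
  (\<open>poly_value_diff_le\<close>). The norm of \<open>p(z)\<close> in \<open>C(K)\<close> is the norm of \<open>p(1, a)\<close>, hence computable.

  What remains is that substitution of polynomials is computable on codes. The predicate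
  \<open>realizable\<close> says that a function between coded sets is induced by a computable function on codes;
  it is preserved by composition, pairing, case distinction and \<open>foldl\<close> over lists, so the
  computability of polynomial arithmetic can be read off from its definition by list functions.
\<close>

section \<open>Total functions computable without an oracle\<close>

text \<open>
  The program must work with every oracle, so that it can serve as a part of an oracle computation.
\<close>

definition total_computable :: "nat \<Rightarrow> (nat list \<Rightarrow> nat) \<Rightarrow> bool" where
  "total_computable n F \<longleftrightarrow> (\<exists>e. \<forall>orc xs. length xs = n \<longrightarrow> oeval orc e xs (F xs))"

definition computable1 :: "(nat \<Rightarrow> nat) \<Rightarrow> bool" where
  "computable1 f \<longleftrightarrow> total_computable 1 (\<lambda>xs. f (xs ! 0))"

definition computable2 :: "(nat \<Rightarrow> nat \<Rightarrow> nat) \<Rightarrow> bool" where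
  "computable2 f \<longleftrightarrow> total_computable 2 (\<lambda>xs. f (xs ! 0) (xs ! 1))"

definition computable3 :: "(nat \<Rightarrow> nat \<Rightarrow> nat \<Rightarrow> nat) \<Rightarrow> bool" where
  "computable3 f \<longleftrightarrow> total_computable 3 (\<lambda>xs. f (xs ! 0) (xs ! 1) (xs ! 2))"

lemmas computableI = iffD2 [OF computable1_def] iffD2 [OF computable2_def] iffD2 [OF computable3_def]

lemma computable1_iff: "computable1 f \<longleftrightarrow> (\<exists>e. \<forall>orc x. oeval orc e [x] (f x))"
proof
  assume "computable1 f"
  then obtain e where "\<forall>orc xs. length xs = 1 \<longrightarrow> oeval orc e xs (f (xs ! 0))"
    unfolding computable1_def total_computable_def by blast
  then have "\<forall>orc x. oeval orc e [x] (f x)"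
    by (metis One_nat_def length_Cons list.size(3) nth_Cons_0)
  then show "\<exists>e. \<forall>orc x. oeval orc e [x] (f x)" by blast
next
  assume "\<exists>e. \<forall>orc x. oeval orc e [x] (f x)"
  then obtain e where e: "\<And>orc x. oeval orc e [x] (f x)" by blast
  have "oeval orc e xs (f (xs ! 0))" if "length xs = 1" for orc xs
    using e that by (cases xs) auto
  then show "computable1 f" unfolding computable1_def total_computable_def by blast
qed

lemma total_computable_proj: "i < n \<Longrightarrow> total_computable n (\<lambda>xs. xs ! i)"
  unfolding total_computable_def by (metis oeval_Proj)

lemma total_computable_comp:
  assumes "total_computable (length Fs) G" "\<And>F. F \<in> set Fs \<Longrightarrow> total_computable n F"
  shows "total_computable n (\<lambda>xs. G (map (\<lambda>F. F xs) Fs))"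
proof -
  obtain g where g: "\<And>orc xs. length xs = length Fs \<Longrightarrow> oeval orc g xs (G xs)"
    using assms(1) unfolding total_computable_def by blast
  have "\<exists>p. \<forall>F\<in>set Fs. \<forall>orc xs. length xs = n \<longrightarrow> oeval orc (p F) xs (F xs)"
    using assms(2) unfolding total_computable_def by (intro bchoice) blast
  then obtain p where p: "\<And>F orc xs. F \<in> set Fs \<Longrightarrow> length xs = n \<Longrightarrow> oeval orc (p F) xs (F xs)"
    by blast
  have "oeval orc (Comp g (map p Fs)) xs (G (map (\<lambda>F. F xs) Fs))" if "length xs = n" for orc xs
    by (rule oeval_Comp [where ys = "map (\<lambda>F. F xs) Fs"]) (use g p that in auto)
  then show ?thesis unfolding total_computable_def by blast
qed

lemma total_computable_comp1:
  assumes "computable1 g" "total_computable n F"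
  shows "total_computable n (\<lambda>xs. g (F xs))"
  using total_computable_comp [of "[F]" "\<lambda>xs. g (xs ! 0)" n] assms
  by (simp add: computable1_def)

lemma total_computable_comp2:
  assumes "computable2 g" "total_computable n F1" "total_computable n F2"
  shows "total_computable n (\<lambda>xs. g (F1 xs) (F2 xs))"
  using total_computable_comp [of "[F1, F2]" "\<lambda>xs. g (xs ! 0) (xs ! 1)" n] assms
  by (auto simp: numeral_2_eq_2 computable2_def)

lemma total_computable_Suc:
  assumes "total_computable n F"
  shows "total_computable n (\<lambda>xs. Suc (F xs))"
proof (rule total_computable_comp1 [OF _ assms])
  show "computable1 Suc" unfolding computable1_iff by (metis oeval_Succ)
qed

lemma total_computable_const: "total_computable n (\<lambda>_. k)"
proof (induction k)
  case 0
  show ?case unfolding total_computable_def by (metis oeval_Zero)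
next
  case (Suc k)
  then show ?case by (rule total_computable_Suc)
qed

lemma computable2_rec_nat:
  assumes "computable1 a" "computable3 s"
  shows "computable2 (\<lambda>m x. rec_nat (a x) (\<lambda>i r. s i r x) m)"
proof -
  obtain f where f: "\<And>orc x. oeval orc f [x] (a x)"
    using assms(1) unfolding computable1_iff by blast
  obtain g where g: "\<And>orc xs. length xs = 3 \<Longrightarrow> oeval orc g xs (s (xs ! 0) (xs ! 1) (xs ! 2))"
    using assms(2) unfolding computable3_def total_computable_def by blast
  have "oeval orc (PrimRec f g) [m, x] (rec_nat (a x) (\<lambda>i r. s i r x) m)" for orc m x
  proof (induction m)
    case 0
    show ?case by (simp add: f oeval_PrimRec_0)
  next
    case (Suc m)
    show ?case
      using oeval_PrimRec_Suc [OF Suc] g [of "[m, rec_nat (a x) (\<lambda>i r. s i r x) m, x]" orc] by simp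
  qed
  then have "oeval orc (PrimRec f g) xs (rec_nat (a (xs ! 1)) (\<lambda>i r. s i r (xs ! 1)) (xs ! 0))"
    if "length xs = 2" for orc xs
    using that by (cases xs; cases "tl xs") auto
  then show ?thesis unfolding computable2_def total_computable_def by blast
qed

lemmas total_computable_basic = computableI total_computable_proj total_computable_const total_computable_Suc

lemma computable1_rec_nat:
  assumes "computable2 s"
  shows "computable1 (\<lambda>m. rec_nat k s m)"
proof -
  have "computable3 (\<lambda>i r x. s i r)"
    by (intro computableI total_computable_comp2 [OF assms] total_computable_basic; simp)
  from computable2_rec_nat [OF computableI(1) [OF total_computable_const] this, of k]
  have "computable2 (\<lambda>m x. rec_nat k s m)" .
  from total_computable_comp2 [OF this, of 1 "\<lambda>xs. xs ! 0" "\<lambda>xs. xs ! 0"]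
  show ?thesis by (simp add: computable1_def computable2_def total_computable_proj)
qed

lemma computable2_add: "computable2 (+)"
proof -
  have "computable2 (\<lambda>m x. rec_nat x (\<lambda>i r. Suc r) m)"
    by (rule computable2_rec_nat; intro total_computable_basic; simp)
  moreover have "rec_nat x (\<lambda>i r. Suc r) m = m + x" for m x by (induction m) auto
  ultimately show ?thesis by simp
qed

lemmas total_computable_add = total_computable_comp2 [OF computable2_add]

lemma computable2_mult: "computable2 (*)"
proof -
  have "computable2 (\<lambda>m x. rec_nat 0 (\<lambda>i r. x + r) m)"
    by (rule computable2_rec_nat; intro total_computable_basic total_computable_add; simp)
  moreover have "rec_nat 0 (\<lambda>i r. x + r) m = m * x" for m x by (induction m) auto
  ultimately show ?thesis by simp
qed

lemmas total_computable_mult = total_computable_comp2 [OF computable2_mult]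

lemma computable2_diff: "computable2 (-)"
proof -
  have "computable1 (\<lambda>m. rec_nat 0 (\<lambda>i r. i) m)"
    by (rule computable1_rec_nat; intro total_computable_basic; simp)
  moreover have "rec_nat 0 (\<lambda>i r. i) m = m - 1" for m by (induction m) auto
  ultimately have pred: "computable1 (\<lambda>m. m - 1)" by simp
  have "computable2 (\<lambda>m x. rec_nat x (\<lambda>i r. r - 1) m)"
    by (rule computable2_rec_nat; intro total_computable_basic total_computable_comp1 [OF pred]; simp)
  moreover have "rec_nat x (\<lambda>i r. r - 1) m = x - m" for m x by (induction m) auto
  ultimately have "computable2 (\<lambda>m x. x - m)" by simp
  from total_computable_comp2 [OF this, of 2 "\<lambda>xs. xs ! 1" "\<lambda>xs. xs ! 0"]
  show ?thesis by (simp add: computable1_def computable2_def total_computable_proj)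
qed

lemmas total_computable_diff = total_computable_comp2 [OF computable2_diff]

lemma total_computable_if:
  assumes "total_computable n C" "total_computable n F" "total_computable n G"
  shows "total_computable n (\<lambda>xs. if C xs = 0 then F xs else G xs)"
proof -
  have "(\<lambda>xs. if C xs = 0 then F xs else G xs) =
    (\<lambda>xs. (1 - C xs) * F xs + (1 - (1 - C xs)) * G xs)"
    by auto
  then show ?thesis by (simp only:) (intro total_computable_add total_computable_mult total_computable_diff total_computable_basic assms)
qed

lemma computable1_mod_2: "computable1 (\<lambda>n. n mod 2)"
proof -
  have "computable1 (\<lambda>m. rec_nat 0 (\<lambda>i r. 1 - r) m)"
    by (rule computable1_rec_nat; intro total_computable_basic total_computable_diff; simp)
  moreover have "rec_nat 0 (\<lambda>i r. 1 - r) m = m mod 2" for m by (induction m) (auto, presburger)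
  ultimately show ?thesis by simp
qed

lemmas total_computable_mod_2 = total_computable_comp1 [OF computable1_mod_2]

lemma computable1_div_2: "computable1 (\<lambda>n. n div 2)"
proof -
  have "computable1 (\<lambda>m. rec_nat 0 (\<lambda>i r. r + i mod 2) m)"
    by (rule computable1_rec_nat; intro total_computable_basic total_computable_add total_computable_mod_2; simp)
  moreover have "rec_nat 0 (\<lambda>i r. r + i mod 2) m = m div 2" for m
    by (induction m) (auto, presburger)
  ultimately show ?thesis by simp
qed

lemmas total_computable_div_2 = total_computable_comp1 [OF computable1_div_2]

lemma computable1_triangle: "computable1 triangle"
proof -
  have "computable1 (\<lambda>m. rec_nat 0 (\<lambda>i r. r + Suc i) m)"
    by (rule computable1_rec_nat; intro total_computable_basic total_computable_add; simp)
  moreover have "rec_nat 0 (\<lambda>i r. r + Suc i) m = triangle m" for m by (induction m) auto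
  ultimately show ?thesis by simp
qed

lemmas total_computable_triangle = total_computable_comp1 [OF computable1_triangle]

lemma computable2_prod_encode: "computable2 (\<lambda>x y. prod_encode (x, y))"
  unfolding prod_encode_def case_prod_conv by (intro total_computable_add total_computable_triangle total_computable_basic; simp)

lemmas total_computable_prod_encode = total_computable_comp2 [OF computable2_prod_encode]

text \<open>
  The number of the diagonal of Cantor's enumeration that contains the pair with code \<open>z\<close>. By a
  recursion on \<open>z\<close> it is computed without search.
\<close>

definition triangle_root :: "nat \<Rightarrow> nat" where
  "triangle_root = rec_nat 0 (\<lambda>i r. if triangle (Suc r) - Suc i = 0 then Suc r else r)"

lemma triangle_root_bounds:
  "triangle (triangle_root z) \<le> z \<and> z < triangle (Suc (triangle_root z))"
  by (induction z) (auto simp: triangle_root_def)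

lemma fst_prod_decode: "fst (prod_decode z) = z - triangle (triangle_root z)"
  and snd_prod_decode: "snd (prod_decode z) = triangle_root z - fst (prod_decode z)"
proof -
  define r where "r = triangle_root z"
  define m where "m = z - triangle r"
  have "triangle r \<le> z" "z < triangle (Suc r)"
    using triangle_root_bounds [of z] by (auto simp: r_def)
  then have "m \<le> r" "z = triangle r + m" unfolding m_def by auto
  then have "z = prod_encode (m, r - m)" by (simp add: prod_encode_def)
  then have "prod_decode z = (m, r - m)" by simp
  then show "fst (prod_decode z) = z - triangle (triangle_root z)"
    "snd (prod_decode z) = triangle_root z - fst (prod_decode z)"
    by (simp_all add: m_def r_def)
qed

lemma computable1_triangle_root: "computable1 triangle_root"
  unfolding triangle_root_def
  by (rule computable1_rec_nat; intro total_computable_if total_computable_diff total_computable_triangle total_computable_basic; simp)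

lemmas total_computable_triangle_root = total_computable_comp1 [OF computable1_triangle_root]

lemma computable1_fst: "computable1 (\<lambda>z. fst (prod_decode z))"
  unfolding fst_prod_decode by (intro total_computable_diff total_computable_triangle total_computable_triangle_root total_computable_basic; simp)

lemma computable1_snd: "computable1 (\<lambda>z. snd (prod_decode z))"
  unfolding snd_prod_decode
  by (intro total_computable_diff total_computable_triangle_root total_computable_basic total_computable_comp1 [OF computable1_fst]; simp)

lemmas total_computable_fst = total_computable_comp1 [OF computable1_fst]
lemmas total_computable_snd = total_computable_comp1 [OF computable1_snd]

lemma total_computable_funpow:
  assumes "computable1 g" "total_computable n M" "total_computable n F"
  shows "total_computable n (\<lambda>xs. (g ^^ M xs) (F xs))"
proof -
  have "computable2 (\<lambda>m x. rec_nat x (\<lambda>i r. g r) m)"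
    by (rule computable2_rec_nat; intro total_computable_basic total_computable_comp1 [OF assms(1)]; simp)
  moreover have "rec_nat x (\<lambda>i r. g r) m = (g ^^ m) x" for m x by (induction m) auto
  ultimately have "computable2 (\<lambda>m x. (g ^^ m) x)" by simp
  from total_computable_comp2 [OF this assms(2,3)] show ?thesis .
qed

lemmas total_computable_intros = total_computable_basic total_computable_add total_computable_mult total_computable_diff total_computable_if total_computable_mod_2 total_computable_div_2 total_computable_prod_encode
  total_computable_fst total_computable_snd

text \<open>
  A program that is run with the constant oracle \<open>0\<close> keeps its results under all oracles when its
  queries are replaced by the constant \<open>0\<close>.
\<close>

primrec without_queries :: "oprog \<Rightarrow> oprog" where
  "without_queries Zero = Zero"
| "without_queries Succ = Succ"
| "without_queries (Proj i) = Proj i"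
| "without_queries Query = Zero"
| "without_queries (Comp f gs) = Comp (without_queries f) (map without_queries gs)"
| "without_queries (PrimRec f g) = PrimRec (without_queries f) (without_queries g)"
| "without_queries (Mu f) = Mu (without_queries f)"

lemma oeval_without_queries: "computes e xs y \<Longrightarrow> oeval orc (without_queries e) xs y"
proof (induction rule: oeval.induct)
  case (oeval_Comp ys gs xs f z)
  then show ?case by (auto intro!: oeval.oeval_Comp [where ys = ys])
next
  case (oeval_Mu f n xs)
  then show ?case by (auto intro!: oeval.oeval_Mu)
qed (auto intro: oeval.intros)

text \<open>
  Computable points are given by programs; this turns such a program into a function.
\<close>

lemma computable1_choice:
  assumes "\<And>k. \<exists>c. computes e [k] c \<and> Q k c"
  obtains g where "computable1 g" "\<And>k. Q k (g k)"
proof -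
  from assms have "\<forall>k. \<exists>c. computes e [k] c \<and> Q k c" by blast
  from choice [OF this] obtain g where g: "\<And>k. computes e [k] (g k)" "\<And>k. Q k (g k)"
    by blast
  have "computable1 g"
    unfolding computable1_iff using oeval_without_queries [OF g(1)] by blast
  with g(2) show ?thesis using that by blast
qed

section \<open>Functions between coded types\<close>

text \<open>
  As codes are not unique, the realizer is a function of codes that need not respect equality of the
  coded objects; only the decoded result is prescribed.
\<close>

definition realizable :: "(nat \<Rightarrow> 'a) \<Rightarrow> (nat \<Rightarrow> 'b) \<Rightarrow> ('a \<Rightarrow> 'b) \<Rightarrow> bool" where
  "realizable dA dB f \<longleftrightarrow> (\<exists>g. computable1 g \<and> (\<forall>n. dB (g n) = f (dA n)))"

definition pair_decoder :: "(nat \<Rightarrow> 'a) \<Rightarrow> (nat \<Rightarrow> 'b) \<Rightarrow> nat \<Rightarrow> 'a \<times> 'b" where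
  "pair_decoder dA dB n = map_prod dA dB (prod_decode n)"

definition list_decoder :: "(nat \<Rightarrow> 'a) \<Rightarrow> nat \<Rightarrow> 'a list" where
  "list_decoder dA n = map dA (list_decode n)"

lemma realizableI: "computable1 g \<Longrightarrow> (\<And>n. dB (g n) = f (dA n)) \<Longrightarrow> realizable dA dB f"
  unfolding realizable_def by blast

lemma realizableE:
  assumes "realizable dA dB f"
  obtains g where "computable1 g" "\<And>n. dB (g n) = f (dA n)"
  using assms unfolding realizable_def by blast

lemma realizable_id: "realizable dA dA (\<lambda>x. x)"
  by (rule realizableI [of "\<lambda>n. n"], intro total_computable_basic, simp_all)

lemma realizable_comp:
  assumes "realizable dB dC g" "realizable dA dB f"
  shows "realizable dA dC (\<lambda>x. g (f x))"
proof -
  from assms(1) obtain g' where g': "computable1 g'" "\<And>n. dC (g' n) = g (dB n)"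
    by (rule realizableE) (rule that)
  from assms(2) obtain f' where f': "computable1 f'" "\<And>n. dB (f' n) = f (dA n)"
    by (rule realizableE) (rule that)
  have "computable1 (\<lambda>n. g' (f' n))"
    using total_computable_comp1 [OF g'(1), of 1] f'(1) by (simp add: computable1_def)
  then show ?thesis by (rule realizableI) (simp add: g'(2) f'(2))
qed

lemma realizable_const: "surj dB \<Longrightarrow> realizable dA dB (\<lambda>_. b)"
  by (rule realizableI [of "\<lambda>_. inv dB b"]) (intro total_computable_basic, simp add: surj_f_inv_f)

lemma realizable_Pair:
  assumes "realizable dA dB f" "realizable dA dC g"
  shows "realizable dA (pair_decoder dB dC) (\<lambda>x. (f x, g x))"
proof -
  from assms(1) obtain f' where "computable1 f'" "\<And>n. dB (f' n) = f (dA n)"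
    by (rule realizableE) (rule that)
  moreover from assms(2) obtain g' where "computable1 g'" "\<And>n. dC (g' n) = g (dA n)"
    by (rule realizableE) (rule that)
  ultimately show ?thesis
    by (intro realizableI [of "\<lambda>n. prod_encode (f' n, g' n)"] computableI total_computable_prod_encode;
      simp add: computable1_def pair_decoder_def)
qed

lemma realizable_fst:
  assumes "realizable dA (pair_decoder dB dC) f"
  shows "realizable dA dB (\<lambda>x. fst (f x))"
proof (rule realizable_comp [OF _ assms])
  show "realizable (pair_decoder dB dC) dB fst"
    by (rule realizableI [OF computable1_fst]) (simp add: pair_decoder_def)
qed

lemma realizable_snd:
  assumes "realizable dA (pair_decoder dB dC) f"
  shows "realizable dA dC (\<lambda>x. snd (f x))"
proof (rule realizable_comp [OF _ assms])
  show "realizable (pair_decoder dB dC) dC snd"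
    by (rule realizableI [OF computable1_snd]) (simp add: pair_decoder_def)
qed

lemma realizable_if:
  assumes "realizable dA id c" "realizable dA dB f" "realizable dA dB g"
  shows "realizable dA dB (\<lambda>x. if c x = 0 then f x else g x)"
proof -
  from assms(1) obtain c' where "computable1 c'" "\<And>n. id (c' n) = c (dA n)"
    by (rule realizableE) (rule that)
  moreover from assms(2) obtain f' where "computable1 f'" "\<And>n. dB (f' n) = f (dA n)"
    by (rule realizableE) (rule that)
  moreover from assms(3) obtain g' where "computable1 g'" "\<And>n. dB (g' n) = g (dA n)"
    by (rule realizableE) (rule that)
  ultimately show ?thesis
    by (intro realizableI [of "\<lambda>n. if c' n = 0 then f' n else g' n"] computableI total_computable_if; simp add: computable1_def)
qed

lemma realizable_Nil: "realizable dA (list_decoder dB) (\<lambda>_. [])"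
  by (rule realizableI [of "\<lambda>_. 0"]) (intro total_computable_basic, simp add: list_decoder_def)

lemma realizable_Cons:
  assumes "realizable dA dB f" "realizable dA (list_decoder dB) g"
  shows "realizable dA (list_decoder dB) (\<lambda>x. f x # g x)"
proof -
  from assms(1) obtain f' where "computable1 f'" "\<And>n. dB (f' n) = f (dA n)"
    by (rule realizableE) (rule that)
  moreover from assms(2) obtain g' where "computable1 g'" "\<And>n. list_decoder dB (g' n) = g (dA n)"
    by (rule realizableE) (rule that)
  ultimately show ?thesis
    by (intro realizableI [of "\<lambda>n. Suc (prod_encode (f' n, g' n))"] total_computable_intros;
      simp add: computable1_def list_decoder_def)
qed

lemma list_decode_pos: "n > 0 \<Longrightarrow>
    list_decode n = fst (prod_decode (n - 1)) # list_decode (snd (prod_decode (n - 1)))"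
  by (cases n) (auto simp: case_prod_beta)

lemma length_list_decode: "length (list_decode n) \<le> n"
proof (induction n rule: list_decode.induct)
  case (2 n)
  obtain x y where "prod_decode n = (x, y)" by fastforce
  moreover from this have "y \<le> n" by (metis le_prod_encode_2 prod_decode_inverse)
  ultimately show ?case using 2 by force
qed auto

lemma list_decode_less: "x \<in> set (list_decode n) \<Longrightarrow> x < n"
proof (induction n rule: list_decode.induct)
  case (2 n)
  obtain u v where "prod_decode n = (u, v)" by fastforce
  moreover from this have "u \<le> n" "v \<le> n"
    by (metis le_prod_encode_1 prod_decode_inverse, metis le_prod_encode_2 prod_decode_inverse)
  ultimately show ?case using 2 by force
qed auto

text \<open>
  The realizer iterates a step on triples of the environment, the code of the list that is still to
  be processed, and the accumulator. A list is no longer than its code, so iterating as often as the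
  code says is enough, and the step does nothing once the list is empty.
\<close>

lemma realizable_foldl:
  assumes xs: "realizable dE (list_decoder dA) xs" and init: "realizable dE dB init"
    and F: "realizable (pair_decoder dE (pair_decoder dB dA)) dB
              (\<lambda>p. F (fst p) (fst (snd p)) (snd (snd p)))"
  shows "realizable dE dB (\<lambda>e. foldl (F e) (init e) (xs e))"
proof -
  obtain h where h: "computable1 h"
    "\<And>n. dB (h n) = F (dE (fst (prod_decode n))) (dB (fst (prod_decode (snd (prod_decode n)))))
                     (dA (snd (prod_decode (snd (prod_decode n)))))"
    using F unfolding realizable_def pair_decoder_def by auto
  obtain xs' where xs': "computable1 xs'" "\<And>n. list_decoder dA (xs' n) = xs (dE n)"
    using xs unfolding realizable_def by blast
  obtain init' where init': "computable1 init'" "\<And>n. dB (init' n) = init (dE n)"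
    using init unfolding realizable_def by blast
  let ?p = "\<lambda>z. fst (prod_decode z)" and ?q = "\<lambda>z. snd (prod_decode z)"
  define step where "step s = (if ?p (?q s) = 0 then s else
      prod_encode (?p s, prod_encode (?q (?p (?q s) - 1),
        h (prod_encode (?p s, prod_encode (?q (?q s), ?p (?p (?q s) - 1)))))))" for s
  have step: "computable1 step"
    unfolding step_def by (intro total_computable_intros total_computable_comp1 [OF h(1)]; simp)
  let ?st = "\<lambda>n l b. prod_encode (n, prod_encode (l, b))"
  have iter: "dB (?q (?q ((step ^^ m) (?st n l b)))) = foldl (F (dE n)) (dB b) (list_decoder dA l)"
    if "length (list_decode l) \<le> m" for m n l b
    using that
  proof (induction m arbitrary: l b)
    case 0
    then show ?case by (auto simp: list_decoder_def)
  next
    case (Suc m)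
    show ?case
    proof (cases "l = 0")
      case True
      have "step (?st n l b) = ?st n l b" using True by (simp add: step_def)
      moreover from this have "(step ^^ m) (?st n l b) = ?st n l b"
        by (induction m) auto
      ultimately show ?thesis using True by (simp add: list_decoder_def)
    next
      case False
      let ?x = "?p (l - 1)" and ?l = "?q (l - 1)"
      have l: "list_decode l = ?x # list_decode ?l" using False by (intro list_decode_pos) auto
      have "step (?st n l b) = ?st n ?l (h (?st n b ?x))" using False by (simp add: step_def)
      then have "(step ^^ Suc m) (?st n l b) = (step ^^ m) (?st n ?l (h (?st n b ?x)))"
        by (simp add: funpow_swap1)
      moreover have "length (list_decode ?l) \<le> m" using Suc.prems l by simp
      ultimately show ?thesis
        using Suc.IH [of ?l "h (?st n b ?x)"] l by (simp add: list_decoder_def h(2))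
    qed
  qed
  show ?thesis
  proof (rule realizableI)
    show "computable1 (\<lambda>n. ?q (?q ((step ^^ xs' n) (?st n (xs' n) (init' n)))))"
      by (intro total_computable_intros total_computable_funpow [OF step]
          total_computable_comp1 [OF xs'(1)] total_computable_comp1 [OF init'(1)]; simp)
    show "dB (?q (?q ((step ^^ xs' n) (?st n (xs' n) (init' n))))) =
        foldl (F (dE n)) (init (dE n)) (xs (dE n))" for n
      using iter [OF length_list_decode] xs'(2) init'(2) by simp
  qed
qed

lemmas realizable_basic = realizable_id realizable_fst realizable_snd realizable_Pair
  realizable_Nil realizable_Cons

lemma realizable_rev:
  assumes "realizable dE (list_decoder dA) xs"
  shows "realizable dE (list_decoder dA) (\<lambda>e. rev (xs e))"
proof -
  have rev: "rev zs = foldl (\<lambda>ys x. x # ys) [] zs" for zs :: "'b list"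
    by (simp add: foldl_conv_fold fold_Cons_rev)
  show ?thesis
    unfolding rev by (rule realizable_foldl [OF assms]) (rule realizable_basic)+
qed

lemma realizable_foldr:
  assumes xs: "realizable dE (list_decoder dA) xs" and init: "realizable dE dB init"
    and F: "realizable (pair_decoder dE (pair_decoder dB dA)) dB
              (\<lambda>p. F (fst p) (snd (snd p)) (fst (snd p)))"
  shows "realizable dE dB (\<lambda>e. foldr (F e) (xs e) (init e))"
  unfolding foldr_conv_foldl by (rule realizable_foldl [OF realizable_rev [OF xs] init F])

lemma realizable_append:
  assumes "realizable dE (list_decoder dA) xs" "realizable dE (list_decoder dA) ys"
  shows "realizable dE (list_decoder dA) (\<lambda>e. xs e @ ys e)"
proof -
  have "xs @ ys = foldr (\<lambda>x zs. x # zs) xs ys" for xs ys :: "'b list" by (induction xs) auto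
  then show ?thesis
    by (simp only:) (rule realizable_foldr [OF assms], (rule realizable_basic)+)
qed

lemma realizable_concat_map:
  assumes xs: "realizable dE (list_decoder dA) xs"
    and F: "realizable (pair_decoder dE dA) (list_decoder dB) (\<lambda>p. F (fst p) (snd p))"
  shows "realizable dE (list_decoder dB) (\<lambda>e. concat (map (F e) (xs e)))"
proof -
  have "concat (map f xs) = foldr (\<lambda>x zs. f x @ zs) xs []" for f :: "'b \<Rightarrow> 'c list" and xs
    by (induction xs) auto
  moreover have "realizable dE (list_decoder dB) (\<lambda>e. foldr (\<lambda>x zs. F e x @ zs) (xs e) [])"
  proof (rule realizable_foldr [OF xs realizable_Nil], rule realizable_append)
    have "realizable (pair_decoder dE (pair_decoder (list_decoder dB) dA)) (pair_decoder dE dA)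
        (\<lambda>p. (fst p, snd (snd p)))"
      by (rule realizable_basic)+
    from realizable_comp [OF F this]
    show "realizable (pair_decoder dE (pair_decoder (list_decoder dB) dA)) (list_decoder dB)
        (\<lambda>p. F (fst p) (snd (snd p)))" by simp
  qed (rule realizable_basic)+
  ultimately show ?thesis by simp
qed

lemma realizable_map:
  assumes "realizable dE (list_decoder dA) xs"
    and F: "realizable (pair_decoder dE dA) dB (\<lambda>p. F (fst p) (snd p))"
  shows "realizable dE (list_decoder dB) (\<lambda>e. map (F e) (xs e))"
proof -
  have "map f xs = concat (map (\<lambda>x. [f x]) xs)" for f :: "'b \<Rightarrow> 'c" and xs
    by (induction xs) auto
  then show ?thesis
    by (simp only:) (rule realizable_concat_map [OF assms(1)], (rule realizable_basic F)+)
qed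


section \<open>Arithmetic of rational star polynomials\<close>

primrec adjoint_var :: "star_var \<Rightarrow> star_var" where
  "adjoint_var (Var i) = AdjVar i"
| "adjoint_var (AdjVar i) = Var i"

definition adjoint_monomial :: "star_monomial \<Rightarrow> star_monomial" where
  "adjoint_monomial m =
     foldl (\<lambda>w u. (adjoint_var u, fst w # snd w)) (adjoint_var (fst m), []) (snd m)"

definition monomial_times :: "star_monomial \<Rightarrow> star_monomial \<Rightarrow> star_monomial" where
  "monomial_times m m' = (fst m, snd m @ fst m' # snd m')"

text \<open>
  The product of two complex coefficients has real part \<open>p p' - q q'\<close>. Since the terms of a
  polynomial need not be collected, the four products are distributed over two terms; this way
  no addition of rational numbers is required, and negation is multiplication by a constant.
\<close>

definition scale_term :: "rat \<times> rat \<Rightarrow> (rat \<times> rat) \<times> star_monomial \<Rightarrow> star_poly" where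
  "scale_term c t =
     [((fst c * fst (fst t), fst c * snd (fst t)), snd t),
      ((snd c * (- 1 * snd (fst t)), snd c * fst (fst t)), snd t)]"

definition poly_scale :: "rat \<times> rat \<Rightarrow> star_poly \<Rightarrow> star_poly" where
  "poly_scale c P = concat (map (scale_term c) P)"

definition poly_times :: "star_poly \<Rightarrow> star_poly \<Rightarrow> star_poly" where
  "poly_times P Q = concat (map (\<lambda>t. concat (map (\<lambda>u.
     scale_term (fst t) (fst u, monomial_times (snd t) (snd u))) Q)) P)"

definition poly_adjoint :: "star_poly \<Rightarrow> star_poly" where
  "poly_adjoint P =
     map (\<lambda>t. ((fst (fst t), - 1 * snd (fst t)), adjoint_monomial (snd t))) P"

primrec adjoint_flag :: "star_var \<Rightarrow> nat" where
  "adjoint_flag (Var i) = 0"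
| "adjoint_flag (AdjVar i) = 1"

definition var_subst :: "star_poly \<times> star_poly \<Rightarrow> star_var \<Rightarrow> star_poly" where
  "var_subst S v =
     (if adjoint_flag v = 0 then if var_index v = 0 then fst S else snd S
      else if var_index v = 0 then poly_adjoint (fst S) else poly_adjoint (snd S))"

definition monomial_subst :: "star_poly \<times> star_poly \<Rightarrow> star_monomial \<Rightarrow> star_poly" where
  "monomial_subst S m =
     foldl (\<lambda>Q u. poly_times Q (var_subst S u)) (var_subst S (fst m)) (snd m)"

text \<open>
  The first polynomial replaces \<open>x\<^sub>0\<close>, the second one every other indeterminate. Standard
  presentations have only the indeterminates \<open>x\<^sub>0\<close> and \<open>x\<^sub>1\<close>.
\<close>

definition poly_subst :: "star_poly \<times> star_poly \<Rightarrow> star_poly \<Rightarrow> star_poly" where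
  "poly_subst S P = concat (map (\<lambda>t. poly_scale (fst t) (monomial_subst S (snd t))) P)"


lemma scaleC_zero [simp]: "c *\<^sub>C (0 :: 'a::complex_star_algebra) = 0"
  using scaleC_add_right [of c 0 "0 :: 'a"] by simp

lemma star_zero [simp]: "star (0 :: 'a::complex_star_algebra) = 0"
  using star_add [of 0 "0 :: 'a"] by simp

lemma poly_value_Nil [simp]: "poly_value s [] = 0"
  by (simp add: poly_value_def)

lemma poly_value_Cons: "poly_value s (t # P) =
    Complex (of_rat (fst (fst t))) (of_rat (snd (fst t))) *\<^sub>C monomial_value s (snd t) +
    poly_value s P"
  by (simp add: poly_value_def case_prod_beta)

lemma poly_value_append: "poly_value s (P @ Q) = poly_value s P + poly_value s Q"
  by (simp add: poly_value_def)

text \<open>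
  A word is evaluated from the left; this peels off its first factor and so gives
  the values of concatenated and reversed words.
\<close>

lemma foldl_mult_left:
  fixes x y :: "'a::semigroup_mult"
  shows "foldl (\<lambda>z u. z * f u) (x * y) us = x * foldl (\<lambda>z u. z * f u) y us"
  by (induction us arbitrary: y) (auto simp: mult.assoc)

lemma monomial_value_times:
  "monomial_value s (monomial_times m m') = monomial_value s m * monomial_value s m'"
  by (simp add: monomial_value_def monomial_times_def case_prod_beta foldl_mult_left)

lemma var_value_adjoint: "var_value s (adjoint_var v) = star (var_value s v)"
  by (cases v) (auto simp: star_star)

lemma monomial_value_adjoint: "monomial_value s (adjoint_monomial m) = star (monomial_value s m)"
proof (cases m)
  case (Pair v vs)
  have "monomial_value s (adjoint_monomial (v, vs)) = star (monomial_value s (v, vs))"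
  proof (induction vs rule: rev_induct)
    case Nil
    show ?case by (simp add: adjoint_monomial_def monomial_value_def var_value_adjoint)
  next
    case (snoc u vs)
    let ?w = "adjoint_monomial (v, vs)"
    have "adjoint_monomial (v, vs @ [u]) = (adjoint_var u, fst ?w # snd ?w)"
      by (simp add: adjoint_monomial_def)
    then have "monomial_value s (adjoint_monomial (v, vs @ [u])) =
        star (var_value s u) * monomial_value s ?w"
      by (simp add: monomial_value_def case_prod_beta foldl_mult_left var_value_adjoint)
    also have "\<dots> = star (monomial_value s (v, vs @ [u]))"
      unfolding snoc by (simp add: monomial_value_def star_mult)
    finally show ?case .
  qed
  with Pair show ?thesis by simp
qed

lemma poly_value_scale_term: "poly_value s (scale_term c t) =
    Complex (of_rat (fst c)) (of_rat (snd c)) *\<^sub>C poly_value s [t]"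
  by (simp add: poly_value_Cons scale_term_def scaleC_scaleC flip: scaleC_add_left)
    (auto simp: of_rat_mult of_rat_minus complex_eq_iff intro!: arg_cong2 [where f = scaleC])

lemma poly_value_scale: "poly_value s (poly_scale c P) =
    Complex (of_rat (fst c)) (of_rat (snd c)) *\<^sub>C poly_value s P"
  unfolding poly_scale_def
proof (induction P)
  case (Cons t P)
  then show ?case
    using poly_value_append [of s "[t]" P]
    by (simp add: poly_value_append poly_value_scale_term scaleC_add_right)
qed simp

lemma poly_value_times: "poly_value s (poly_times P Q) = poly_value s P * poly_value s Q"
  unfolding poly_times_def
proof (induction P)
  case (Cons t P)
  have "poly_value s (concat (map (\<lambda>u.
      scale_term (fst t) (fst u, monomial_times (snd t) (snd u))) Q)) = poly_value s [t] * poly_value s Q"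
    by (induction Q)
      (simp_all add: poly_value_append poly_value_scale_term poly_value_Cons monomial_value_times
        scaleC_scaleC mult_scaleC_left mult_scaleC_right distrib_left mult.commute scaleC_add_right)
  then show ?case
    using poly_value_append [of s "[t]" P] Cons
    by (simp add: poly_value_append distrib_right)
qed simp

lemma poly_value_adjoint: "poly_value s (poly_adjoint P) = star (poly_value s P)"
proof (induction P)
  case (Cons t P)
  have "cnj (Complex x y) = Complex x (- y)" for x y by (simp add: complex_eq_iff)
  with Cons show ?case
    by (simp add: poly_adjoint_def poly_value_Cons star_add star_scaleC monomial_value_adjoint
        of_rat_minus)
qed (simp add: poly_adjoint_def)

lemma poly_value_subst:
  "poly_value s (poly_subst S P) =
   poly_value (\<lambda>i. if i = 0 then poly_value s (fst S) else poly_value s (snd S)) P"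
proof -
  let ?t = "\<lambda>i::nat. if i = 0 then poly_value s (fst S) else poly_value s (snd S)"
  have var: "poly_value s (var_subst S v) = var_value ?t v" for v
    by (cases v) (auto simp: var_subst_def poly_value_adjoint)
  have "poly_value s (monomial_subst S (v, vs)) = monomial_value ?t (v, vs)" for v vs
    by (induction vs rule: rev_induct)
      (simp_all add: monomial_subst_def monomial_value_def var poly_value_times)
  then have mono: "poly_value s (monomial_subst S m) = monomial_value ?t m" for m
    by (metis prod.collapse)
  show ?thesis
    unfolding poly_subst_def
    by (induction P) (simp_all add: poly_value_append poly_value_scale poly_value_Cons mono)
qed

definition poly_over :: "enat \<Rightarrow> star_poly \<Rightarrow> bool" where
  "poly_over N P \<longleftrightarrow> (\<forall>v\<in>poly_vars P. enat (var_index v) < N)"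

lemma poly_over_iff: "poly_over N P \<longleftrightarrow>
    (\<forall>t\<in>set P. \<forall>v\<in>set (fst (snd t) # snd (snd t)). enat (var_index v) < N)"
  unfolding poly_over_def poly_vars_def by fastforce

lemma poly_over_concat: "(\<And>P. P \<in> set Ps \<Longrightarrow> poly_over N P) \<Longrightarrow> poly_over N (concat Ps)"
  by (auto simp: poly_over_iff)

lemma poly_over_scale: "poly_over N P \<Longrightarrow> poly_over N (poly_scale c P)"
  by (auto simp: poly_over_iff poly_scale_def scale_term_def)

lemma poly_over_times: "poly_over N P \<Longrightarrow> poly_over N Q \<Longrightarrow> poly_over N (poly_times P Q)"
  by (fastforce simp: poly_over_iff poly_times_def scale_term_def monomial_times_def)

lemma var_index_adjoint [simp]: "var_index (adjoint_var v) = var_index v"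
  by (cases v) auto

lemma set_adjoint_monomial:
  "set (fst (adjoint_monomial m) # snd (adjoint_monomial m)) =
    adjoint_var ` set (fst m # snd m)"
proof (cases m)
  case (Pair v vs)
  have "set (fst (adjoint_monomial (v, vs)) # snd (adjoint_monomial (v, vs))) =
      adjoint_var ` set (v # vs)"
    by (induction vs rule: rev_induct) (auto simp: adjoint_monomial_def)
  with Pair show ?thesis by simp
qed

lemma poly_over_adjoint: "poly_over N P \<Longrightarrow> poly_over N (poly_adjoint P)"
  unfolding poly_over_iff poly_adjoint_def
  using set_adjoint_monomial by (auto simp del: set_simps)

lemma poly_over_subst:
  assumes "poly_over N (fst S)" "poly_over N (snd S)"
  shows "poly_over N (poly_subst S P)"
proof -
  have var: "poly_over N (var_subst S v)" for v
    using assms by (auto simp: var_subst_def poly_over_adjoint)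
  have "poly_over N (foldl (\<lambda>Q u. poly_times Q (var_subst S u)) Q us)" if "poly_over N Q" for Q us
    using that by (induction us arbitrary: Q) (auto intro: poly_over_times var)
  then have "poly_over N (monomial_subst S m)" for m
    unfolding monomial_subst_def using var by blast
  then show ?thesis
    unfolding poly_subst_def by (auto intro!: poly_over_concat poly_over_scale)
qed


section \<open>Computing with codes of polynomials\<close>

lemma coeff_decode_eq: "coeff_decode = pair_decoder rat_decode rat_decode"
  by (simp add: fun_eq_iff coeff_decode_def pair_decoder_def)

lemma monomial_decode_eq: "monomial_decode = pair_decoder var_decode (list_decoder var_decode)"
  by (simp add: fun_eq_iff monomial_decode_def pair_decoder_def list_decoder_def
      map_prod_def case_prod_beta)

lemma poly_decode_eq: "poly_decode = list_decoder (pair_decoder coeff_decode monomial_decode)"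
  by (auto simp: fun_eq_iff poly_decode_def pair_decoder_def list_decoder_def)

lemma realizable_comp2:
  assumes "realizable (pair_decoder dB dC) dD (\<lambda>p. h (fst p) (snd p))"
    "realizable dA dB f" "realizable dA dC g"
  shows "realizable dA dD (\<lambda>x. h (f x) (g x))"
  using realizable_comp [OF assms(1) realizable_Pair [OF assms(2,3)]] by simp

lemma int_decode_sign:
  "int_decode n = (if even n then 1 else - 1) * int ((n + 1) div 2)"
  by (auto simp: int_decode_def sum_decode_def elim!: oddE)

text \<open>
  The parity of a code is the sign, and half of the code, rounded up, is the absolute value. Absolute
  values are multiplied and signs are added modulo \<open>2\<close>. Truncated subtraction handles the
  product \<open>0\<close> with a negative sign correctly.
\<close>

lemma int_decode_mult:
  "int_decode (2 * (((a + 1) div 2) * ((b + 1) div 2)) - (a + b) mod 2) =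
   int_decode a * int_decode b"
proof -
  have *: "int_decode (2 * m - s) = (if s = 0 then 1 else - 1) * int m" if "s < 2" for m s
  proof -
    have "s = 0 \<or> s = 1" using that by auto
    then show ?thesis by (cases m) (auto simp: int_decode_def sum_decode_def)
  qed
  show ?thesis
    by (subst *) (auto simp: int_decode_sign [of a] int_decode_sign [of b] mod2_eq_if)
qed

lemma realizable_rat_mult:
  "realizable (pair_decoder rat_decode rat_decode) rat_decode (\<lambda>p. fst p * snd p)"
proof -
  let ?p = "\<lambda>z. fst (prod_decode z)" and ?q = "\<lambda>z. snd (prod_decode z)"
  let ?imul = "\<lambda>a b. 2 * (((a + 1) div 2) * ((b + 1) div 2)) - (a + b) mod 2 :: nat"
  let ?g = "\<lambda>n. prod_encode (?imul (?p (?p n)) (?p (?q n)),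
                  Suc (?q (?p n)) * Suc (?q (?q n)) - 1)"
  show ?thesis
  proof (rule realizableI [of ?g])
    show "computable1 ?g" by (intro total_computable_intros; simp)
    have rat: "rat_decode n = of_int (int_decode (?p n)) / of_nat (Suc (?q n))" for n
      by (simp add: rat_decode_def case_prod_beta)
    have g: "rat_decode (?g n) = of_int (int_decode (?p (?p n)) * int_decode (?p (?q n))) /
        of_nat (Suc (?q (?p n)) * Suc (?q (?q n)))" for n
      unfolding rat prod_encode_inverse fst_conv snd_conv int_decode_mult by simp
    show "rat_decode (?g n) = fst (pair_decoder rat_decode rat_decode n) *
        snd (pair_decoder rat_decode rat_decode n)" for n
      unfolding g by (simp add: pair_decoder_def rat del: mult_Suc mult_Suc_right)
  qed
qed

lemma realizable_adjoint_var: "realizable var_decode var_decode adjoint_var"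
proof (rule realizableI)
  show "computable1 (\<lambda>n. n + 1 - 2 * (n mod 2))" by (intro total_computable_intros; simp)
  show "var_decode (n + 1 - 2 * (n mod 2)) = adjoint_var (var_decode n)" for n
    by (cases "even n") (auto simp: var_decode_def sum_decode_def elim!: evenE oddE)
qed

lemma realizable_var_index: "realizable var_decode id var_index"
proof (rule realizableI)
  show "computable1 (\<lambda>n. n div 2)" by (intro total_computable_intros; simp)
  show "id (n div 2) = var_index (var_decode n)" for n
    by (auto simp: var_decode_def sum_decode_def)
qed

lemma realizable_adjoint_flag: "realizable var_decode id adjoint_flag"
proof (rule realizableI)
  show "computable1 (\<lambda>n. n mod 2)" by (intro total_computable_intros; simp)
  show "id (n mod 2) = adjoint_flag (var_decode n)" for n
    by (auto simp: var_decode_def sum_decode_def mod2_eq_if)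
qed

lemmas realizable_arith = realizable_basic realizable_const [OF surj_rat_decode]
  realizable_comp2 [OF realizable_rat_mult]
  realizable_comp [OF realizable_adjoint_var] realizable_comp [OF realizable_var_index]
  realizable_comp [OF realizable_adjoint_flag] realizable_append

lemma realizable_adjoint_monomial:
  "realizable monomial_decode monomial_decode adjoint_monomial"
  unfolding adjoint_monomial_def [abs_def] monomial_decode_eq
  by (rule realizable_foldl realizable_arith)+

lemma realizable_monomial_times:
  "realizable (pair_decoder monomial_decode monomial_decode) monomial_decode
    (\<lambda>p. monomial_times (fst p) (snd p))"
  unfolding monomial_times_def monomial_decode_eq by (rule realizable_arith)+

lemma realizable_scale_term:
  "realizable (pair_decoder coeff_decode (pair_decoder coeff_decode monomial_decode)) poly_decode
    (\<lambda>p. scale_term (fst p) (snd p))"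
  unfolding scale_term_def poly_decode_eq coeff_decode_eq by (rule realizable_arith)+

lemma realizable_poly_scale:
  "realizable (pair_decoder coeff_decode poly_decode) poly_decode
    (\<lambda>p. poly_scale (fst p) (snd p))"
  unfolding poly_scale_def poly_decode_eq
  by (rule realizable_concat_map realizable_basic
      realizable_comp2 [OF realizable_scale_term, unfolded poly_decode_eq])+

lemma realizable_poly_times:
  "realizable (pair_decoder poly_decode poly_decode) poly_decode
    (\<lambda>p. poly_times (fst p) (snd p))"
  unfolding poly_times_def poly_decode_eq
  by (rule realizable_concat_map realizable_basic realizable_comp2 [OF realizable_monomial_times]
      realizable_comp2 [OF realizable_scale_term, unfolded poly_decode_eq])+

lemma realizable_poly_adjoint: "realizable poly_decode poly_decode poly_adjoint"
  unfolding poly_adjoint_def [abs_def] poly_decode_eq coeff_decode_eq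
  by (rule realizable_map realizable_arith realizable_comp [OF realizable_adjoint_monomial])+

lemma realizable_var_subst:
  "realizable (pair_decoder (pair_decoder poly_decode poly_decode) var_decode) poly_decode
    (\<lambda>p. var_subst (fst p) (snd p))"
  unfolding var_subst_def
  by (rule realizable_if realizable_arith realizable_comp [OF realizable_poly_adjoint])+

lemma realizable_monomial_subst:
  "realizable (pair_decoder (pair_decoder poly_decode poly_decode) monomial_decode) poly_decode
    (\<lambda>p. monomial_subst (fst p) (snd p))"
  unfolding monomial_subst_def monomial_decode_eq
  by (rule realizable_foldl realizable_basic realizable_comp2 [OF realizable_poly_times]
      realizable_comp2 [OF realizable_var_subst])+

lemma realizable_poly_subst:
  "realizable (pair_decoder (pair_decoder poly_decode poly_decode) poly_decode) poly_decode
    (\<lambda>p. poly_subst (fst p) (snd p))"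
  unfolding poly_subst_def
  by (rule realizable_basic realizable_comp2 [OF realizable_poly_scale]
      realizable_comp2 [OF realizable_monomial_subst]
      realizable_concat_map [where dA = "pair_decoder coeff_decode monomial_decode"
        and dB = "pair_decoder coeff_decode monomial_decode", folded poly_decode_eq])+


section \<open>Evaluating polynomials at computable points\<close>

text \<open>
  From \<open>\<parallel>y\<parallel>\<^sup>2 = \<parallel>y\<^sup>* y\<parallel> \<le> \<parallel>y\<^sup>*\<parallel> \<parallel>y\<parallel>\<close>, applied to \<open>x\<close> and to its adjoint.
\<close>

lemma norm_star [simp]: "norm (star x) = norm (x :: 'a::cstar_algebra)"
proof -
  have le: "norm y \<le> norm (star y)" for y :: 'a
  proof (cases "norm y = 0")
    case False
    have "(norm y)\<^sup>2 \<le> norm (star y) * norm y"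
      using norm_mult_ineq [of "star y" y] by (simp add: cstar_identity)
    with False show ?thesis by (simp add: power2_eq_square)
  qed simp
  show ?thesis using le [of x] le [of "star x"] by (simp add: star_star)
qed

lemma star_diff: "star (x - y) = star x - star (y :: 'a::complex_star_algebra)"
  using star_add [of "x - y" y] by (simp add: algebra_simps)

lemma scaleC_diff_right: "c *\<^sub>C (x - y) = c *\<^sub>C x - c *\<^sub>C (y :: 'a::complex_star_algebra)"
  using scaleC_add_right [of c "x - y" y] by (simp add: algebra_simps)

lemma prod_decode_le: "fst (prod_decode n) \<le> n" "snd (prod_decode n) \<le> n"
  using le_prod_encode_1 [of "fst (prod_decode n)" "snd (prod_decode n)"]
    le_prod_encode_2 [of "snd (prod_decode n)" "fst (prod_decode n)"] by simp_all

lemma rat_decode_bound: "\<bar>real_of_rat (rat_decode n)\<bar> \<le> real n"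
proof -
  obtain u v where uv: "prod_decode n = (u, v)" by fastforce
  have "\<bar>real_of_int (int_decode u)\<bar> \<le> real u"
    by (auto simp: int_decode_def sum_decode_def elim!: oddE)
  moreover have "u \<le> n" using prod_decode_le(1) [of n] uv by simp
  moreover have "\<bar>real_of_int (int_decode u) / real (Suc v)\<bar> \<le> \<bar>real_of_int (int_decode u)\<bar>"
    by (simp add: divide_le_eq mult_le_cancel_left1)
  ultimately show ?thesis
    using uv by (simp add: rat_decode_def of_rat_divide del: of_nat_Suc)
qed

lemma coeff_decode_bound:
  "cmod (Complex (of_rat (fst (coeff_decode n))) (of_rat (snd (coeff_decode n)))) \<le> 2 * real n"
proof -
  obtain u v where uv: "prod_decode n = (u, v)" by fastforce
  have "u \<le> n" "v \<le> n" using prod_decode_le [of n] uv by simp_all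
  then show ?thesis
    using cmod_le [of "Complex (of_rat (rat_decode u)) (of_rat (rat_decode v))"]
      rat_decode_bound [of u] rat_decode_bound [of v] uv
    by (simp add: coeff_decode_def)
qed

lemma norm_diff_mult_le:
  fixes x x' y y' :: "'a::real_normed_algebra"
  shows "norm (x * y - x' * y') \<le> norm (x - x') * norm y + norm x' * norm (y - y')"
proof -
  have "x * y - x' * y' = (x - x') * y + x' * (y - y')" by (simp add: algebra_simps)
  then show ?thesis
    by (simp only:) (intro norm_triangle_le add_mono norm_mult_ineq)
qed

lemma norm_sum_list_le_length:
  fixes f :: "'b \<Rightarrow> 'a::real_normed_vector"
  assumes "\<And>x. x \<in> set xs \<Longrightarrow> norm (f x) \<le> d"
  shows "norm (\<Sum>x\<leftarrow>xs. f x) \<le> real (length xs) * d"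
  using assms
proof (induction xs)
  case (Cons x xs)
  have "norm (f x + (\<Sum>x\<leftarrow>xs. f x)) \<le> d + real (length xs) * d"
    using Cons by (intro norm_triangle_le add_mono) auto
  then show ?case by (simp add: algebra_simps)
qed simp

text \<open>
  Replacing the factors one after the other costs at most \<open>\<delta>\<close> times the bounds of the other factors;
  one superfluous factor \<open>B \<ge> 1\<close> keeps the exponent equal to the length.
\<close>

lemma monomial_value_diff_le:
  fixes t u :: "nat \<Rightarrow> 'a::cstar_algebra"
  assumes "B \<ge> 1" and t: "\<And>i. norm (t i) \<le> B" and u: "\<And>i. norm (u i) \<le> B"
    and tu: "\<And>i. norm (t i - u i) \<le> \<delta>"
  shows "norm (monomial_value t m - monomial_value u m) \<le>
    real (Suc (length (snd m))) * B ^ Suc (length (snd m)) * \<delta>"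
proof -
  have \<delta>: "\<delta> \<ge> 0" using tu [of 0] norm_ge_zero order_trans by blast
  have vt: "norm (var_value t w) \<le> B" for w by (cases w) (auto simp: t)
  have vtu: "norm (var_value t w - var_value u w) \<le> \<delta>" for w
    by (cases w) (auto simp: tu simp flip: star_diff)
  have vu: "norm (var_value u w) \<le> B" for w by (cases w) (auto simp: u)
  obtain v vs where m: "m = (v, vs)" by fastforce
  have "norm (monomial_value u (v, vs)) \<le> B ^ Suc (length vs) \<and>
      norm (monomial_value t (v, vs) - monomial_value u (v, vs)) \<le>
        real (Suc (length vs)) * B ^ Suc (length vs) * \<delta>"
  proof (induction vs rule: rev_induct)
    case Nil
    have "\<delta> \<le> B * \<delta>" using \<open>B \<ge> 1\<close> \<delta> by (simp add: mult_le_cancel_right1)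
    then show ?case using vu [of v] vtu [of v] by (simp add: monomial_value_def)
  next
    case (snoc w vs)
    define x y where "x = monomial_value t (v, vs)" and "y = monomial_value u (v, vs)"
    let ?k = "Suc (length vs)"
    have x: "monomial_value t (v, vs @ [w]) = x * var_value t w"
      and y: "monomial_value u (v, vs @ [w]) = y * var_value u w"
      by (simp_all add: monomial_value_def x_def y_def)
    have IH: "norm y \<le> B ^ ?k" "norm (x - y) \<le> real ?k * B ^ ?k * \<delta>"
      using snoc by (simp_all add: x_def y_def)
    have "norm (y * var_value u w) \<le> B ^ ?k * B"
      using IH vu [of w] \<open>B \<ge> 1\<close> by (intro order_trans [OF norm_mult_ineq] mult_mono) auto
    moreover have "norm (x * var_value t w - y * var_value u w) \<le>
        (real ?k * B ^ ?k * \<delta>) * B + B ^ ?k * \<delta>"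
      using IH vt [of w] vtu [of w] \<open>B \<ge> 1\<close> \<delta>
      by (intro order_trans [OF norm_diff_mult_le] add_mono mult_mono) auto
    moreover have "B ^ ?k * \<delta> \<le> B ^ ?k * B * \<delta>"
    proof -
      have "B ^ ?k * 1 \<le> B ^ ?k * B" using \<open>B \<ge> 1\<close> by (intro mult_left_mono) auto
      then show ?thesis using \<delta> by (intro mult_right_mono) auto
    qed
    ultimately show ?case
      unfolding x y length_append by (simp add: algebra_simps)
  qed
  then show ?thesis by (simp add: m)
qed

text \<open>
  The code \<open>c\<close> bounds the number of terms, the length of every word and half the modulus of every
  coefficient. The error is therefore at most \<open>c * (2 * c) * (c * 2 ^ (b * c) * \<delta>)\<close>, and \<open>c \<le> 2\<^sup>c\<close> turns this
  into a modulus that is evidently computable.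
\<close>

lemma poly_value_diff_le:
  fixes t u :: "nat \<Rightarrow> 'a::cstar_algebra"
  assumes "\<And>i. norm (t i) \<le> 2 ^ b" and "\<And>i. norm (u i) \<le> 2 ^ b"
    and tu: "\<And>i. norm (t i - u i) \<le> \<delta>"
  shows "norm (poly_value t (poly_decode c) - poly_value u (poly_decode c)) \<le>
    2 ^ (1 + (3 + b) * c) * \<delta>"
proof -
  have \<delta>: "\<delta> \<ge> 0" using tu [of 0] norm_ge_zero order_trans by blast
  define f where "f n = (let k = coeff_decode (fst (prod_decode n));
       m = monomial_decode (snd (prod_decode n)) in
     Complex (of_rat (fst k)) (of_rat (snd k)) *\<^sub>C (monomial_value t m - monomial_value u m))" for n
  have "poly_value t (map (map_prod coeff_decode monomial_decode \<circ> prod_decode) ns) -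
      poly_value u (map (map_prod coeff_decode monomial_decode \<circ> prod_decode) ns) = sum_list (map f ns)" for ns
    by (induction ns) (simp_all add: poly_value_Cons f_def Let_def scaleC_diff_right add_diff_add)
  then have eq: "poly_value t (poly_decode c) - poly_value u (poly_decode c) =
      sum_list (map f (list_decode c))"
    unfolding poly_decode_def by blast
  have f: "norm (f n) \<le> 2 * real c * (real c * (2 ^ b) ^ c * \<delta>)" if "n \<in> set (list_decode c)" for n
  proof -
    obtain i j where ij: "prod_decode n = (i, j)" by fastforce
    have n: "n < c" using list_decode_less that by blast
    then have i: "i \<le> c" and j: "j < c" using prod_decode_le [of n] ij by auto
    let ?l = "length (snd (monomial_decode j))"
    have "?l \<le> j"
      using length_list_decode [of "snd (prod_decode j)"] prod_decode_le(2) [of j]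
      by (simp add: monomial_decode_def map_prod_def case_prod_beta)
    then have l: "Suc ?l \<le> c" using j by simp
    have "norm (monomial_value t (monomial_decode j) - monomial_value u (monomial_decode j)) \<le>
        real (Suc ?l) * (2 ^ b) ^ Suc ?l * \<delta>"
      by (rule monomial_value_diff_le) (use assms in auto)
    also have "\<dots> \<le> real c * (2 ^ b) ^ c * \<delta>"
      using l \<delta> by (intro mult_mono power_increasing) (auto simp del: power_Suc of_nat_Suc)
    finally have mono: "norm (monomial_value t (monomial_decode j) -
        monomial_value u (monomial_decode j)) \<le> real c * (2 ^ b) ^ c * \<delta>" .
    have "cmod (Complex (of_rat (fst (coeff_decode i))) (of_rat (snd (coeff_decode i)))) \<le> 2 * real c"
      using coeff_decode_bound [of i] i by linarith
    then show ?thesis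
      using mono unfolding f_def Let_def ij fst_conv snd_conv norm_scaleC by (intro mult_mono) auto
  qed
  have "norm (sum_list (map f (list_decode c))) \<le>
      real (length (list_decode c)) * (2 * real c * (real c * (2 ^ b) ^ c * \<delta>))"
    using f by (rule norm_sum_list_le_length)
  also have "\<dots> \<le> real c * (2 * real c * (real c * (2 ^ b) ^ c * \<delta>))"
    using length_list_decode [of c] \<delta> by (intro mult_right_mono) auto
  also have "\<dots> = 2 * (real c * real c * real c) * (2 ^ b) ^ c * \<delta>" by (simp add: algebra_simps)
  also have "\<dots> \<le> 2 * (2 ^ c * 2 ^ c * 2 ^ c) * (2 ^ b) ^ c * \<delta>"
  proof -
    have "real c \<le> 2 ^ c" using of_nat_less_two_power [of c, where 'a = real] by simp
    then show ?thesis using \<delta> by (intro mult_mono) auto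
  qed
  also have "\<dots> = 2 ^ (1 + (3 + b) * c) * \<delta>"
  proof -
    have "1 + (3 + b) * c = 1 + (c + c + c) + b * c" by (simp add: algebra_simps)
    then show ?thesis by (simp only: power_add power_mult power_one_right)
  qed
  finally show ?thesis using eq by simp
qed

lemma computable_evaluation:
  fixes s :: "nat \<Rightarrow> 'a::cstar_algebra"
  assumes "computable_point (presented_by N s) x" "computable_point (presented_by N s) y"
  obtains g where "computable2 g"
    "\<And>c k. is_code (presented_by N s) (g c k)"
    "\<And>c k. norm (poly_value (\<lambda>i. if i = 0 then x else y) (poly_decode c) -
              generated_point (presented_by N s) (g c k)) < 1 / 2 ^ k"
proof -
  let ?Q = "presented_by N s"
  have ex: "\<exists>X. computable1 X \<and> (\<forall>k. is_code ?Q (X k) \<and>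
      norm (z - generated_point ?Q (X k)) < 1 / 2 ^ k)" if "computable_point ?Q z" for z
  proof -
    from that obtain e where
      "\<And>k. \<exists>c. computes e [k] c \<and> is_code ?Q c \<and> norm (z - generated_point ?Q c) < 1 / 2 ^ k"
      unfolding computable_point_def by (auto simp: presented_by_def)
    from computable1_choice [where Q = "\<lambda>k c. is_code ?Q c \<and> norm (z - generated_point ?Q c) < 1 / 2 ^ k",
        OF this]
    show ?thesis by blast
  qed
  obtain X where X: "computable1 X" "\<And>k. is_code ?Q (X k)"
    "\<And>k. norm (x - generated_point ?Q (X k)) < 1 / 2 ^ k"
    using ex [OF assms(1)] by blast
  obtain Y where Y: "computable1 Y" "\<And>k. is_code ?Q (Y k)"
    "\<And>k. norm (y - generated_point ?Q (Y k)) < 1 / 2 ^ k"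
    using ex [OF assms(2)] by blast
  obtain h where h: "computable1 h" "\<And>n. poly_decode (h n) =
      poly_subst (fst (pair_decoder (pair_decoder poly_decode poly_decode) poly_decode n))
        (snd (pair_decoder (pair_decoder poly_decode poly_decode) poly_decode n))"
    using realizable_poly_subst unfolding realizable_def by blast
  (* One is added so that the approximations, too, are bounded by 2 ^ b. *)
  obtain b where b: "max (norm x) (norm y) + 1 \<le> 2 ^ b"
    using real_arch_pow [of 2 "max (norm x) (norm y) + 1"] by (auto intro: less_imp_le)
  (* The error bound 2 ^ (1 + (3 + b) * c) * 2 ^ - j then equals 2 ^ - (k + 1). *)
  define j where "j c k = k + 2 + (3 + b) * c" for c k
  define g where "g c k = h (prod_encode (prod_encode (X (j c k), Y (j c k)), c))" for c k
  have g: "poly_decode (g c k) =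
      poly_subst (poly_decode (X (j c k)), poly_decode (Y (j c k))) (poly_decode c)" for c k
    by (simp add: g_def h pair_decoder_def)
  show thesis
  proof (rule that)
    show "computable2 g"
      unfolding g_def j_def
      by (intro total_computable_intros total_computable_comp1 [OF h(1)] total_computable_comp1 [OF X(1)]
          total_computable_comp1 [OF Y(1)]; simp)
  next
    fix c k
    show "is_code ?Q (g c k)"
      using X(2) Y(2) poly_over_subst [of N "(poly_decode (X (j c k)), poly_decode (Y (j c k)))"]
      by (simp add: is_code_def presented_by_def g flip: poly_over_def)
  next
    fix c k
    define t where "t = (\<lambda>i::nat. if i = 0 then x else y)"
    define u where "u = (\<lambda>i::nat. if i = 0 then generated_point ?Q (X (j c k))
      else generated_point ?Q (Y (j c k)))"
    have "norm (t i - u i) < 1 / 2 ^ j c k" for i using X(3) Y(3) by (simp add: t_def u_def)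
    then have tu: "norm (t i - u i) \<le> 1 / 2 ^ j c k" for i using less_imp_le by blast
    have t: "norm (t i) \<le> 2 ^ b" for i using b by (auto simp: t_def)
    have "norm (u i) \<le> 2 ^ b" for i
    proof -
      have "1 / 2 ^ j c k \<le> (1 :: real)" by simp
      with tu [of i] have "norm (t i - u i) \<le> 1" by linarith
      moreover have "norm (t i) \<le> max (norm x) (norm y)" by (simp add: t_def)
      moreover have "norm (u i) \<le> norm (t i) + norm (t i - u i)"
        using norm_triangle_ineq4 [of "t i" "t i - u i"] by simp
      ultimately show ?thesis using b by linarith
    qed
    with t have "norm (poly_value t (poly_decode c) - poly_value u (poly_decode c)) \<le>
        2 ^ (1 + (3 + b) * c) * (1 / 2 ^ j c k)"
      using tu by (rule poly_value_diff_le)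
    also have "\<dots> = (1 / 2) * (1 / 2 ^ k)"
      by (simp add: j_def power_add)
    also have "\<dots> < 1 / 2 ^ k" by (simp add: divide_simps)
    also have "poly_value u (poly_decode c) = generated_point ?Q (g c k)"
      by (simp add: generated_point_def g poly_value_subst u_def cong: if_cong)
    finally show "norm (poly_value (\<lambda>i. if i = 0 then x else y) (poly_decode c) -
              generated_point ?Q (g c k)) < 1 / 2 ^ k" by (simp add: t_def)
  qed
qed


section \<open>Invertibility and the spectrum\<close>

lemma star_one: "star 1 = (1 :: 'a::unital_cstar_algebra)"
proof -
  have "star (star (1 :: 'a) * 1) = star 1 * star (star 1)" by (rule star_mult)
  then have "1 = star (1 :: 'a)" by (simp add: star_star)
  then show ?thesis by (rule sym)
qed

lemma norm_one_le: "norm (1 :: 'a::unital_cstar_algebra) \<le> 1"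
  using cstar_identity [of "1 :: 'a"] by (auto simp: star_one power2_eq_square)

text \<open>
  The inverse is the Neumann series. Only \<open>norm 1 \<le> 1\<close> is available for its first term, because
  the algebra may be zero.
\<close>

lemma neumann_inverse:
  fixes x :: "'a::unital_cstar_algebra"
  assumes "norm x < 1"
  obtains b where "b * (1 - x) = 1" "(1 - x) * b = 1"
proof -
  have le: "norm (x ^ n) \<le> norm x ^ n" for n
  proof (induction n)
    case 0
    show ?case using norm_one_le by simp
  next
    case (Suc n)
    then have "norm x * norm (x ^ n) \<le> norm x * norm x ^ n" by (rule mult_left_mono) simp
    then show ?case using norm_mult_ineq [of x "x ^ n"] by simp
  qed
  have s: "summable (\<lambda>n. x ^ n)"
    by (rule summable_comparison_test' [of "\<lambda>n. norm x ^ n" 0])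
      (use assms le in \<open>auto intro: summable_geometric\<close>)
  define b where "b = (\<Sum>n. x ^ n)"
  have "b = 1 + (\<Sum>n. x ^ Suc n)" using suminf_split_head [OF s] by (simp add: b_def)
  moreover have "(\<Sum>n. x ^ Suc n) = x * b" using suminf_mult [OF s, of x] by (simp add: b_def)
  moreover have "(\<Sum>n. x ^ Suc n) = b * x"
    using suminf_mult2 [OF s, of x] by (simp add: b_def power_commutes)
  ultimately have b: "b = 1 + x * b" "b = 1 + b * x" by simp_all
  have "b * (1 - x) = b - b * x" "(1 - x) * b = b - x * b"
    by (simp_all add: right_diff_distrib left_diff_distrib)
  moreover have "b - b * x = 1" "b - x * b = 1"
    using b by (simp_all add: diff_eq_eq)
  ultimately show thesis using that by metis
qed

lemma spectrum_iff:
  "l \<notin> spectrum a \<longleftrightarrow> (\<exists>b. b * (l *\<^sub>C 1 - a) = 1 \<and> (l *\<^sub>C 1 - a) * b = 1)"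
  by (simp add: spectrum_def)

lemma cmod_le_norm_if_in_spectrum:
  assumes "l \<in> spectrum a"
  shows "cmod l \<le> norm a"
proof (rule ccontr)
  assume "\<not> cmod l \<le> norm a"
  then have l: "norm a < cmod l" "l \<noteq> 0" using norm_ge_zero [of a] by auto
  define x where "x = (1 / l) *\<^sub>C a"
  have "norm x < 1" using l by (simp add: x_def norm_scaleC norm_divide divide_less_eq)
  then obtain b where b: "b * (1 - x) = 1" "(1 - x) * b = 1" by (rule neumann_inverse)
  have "l *\<^sub>C 1 - a = l *\<^sub>C (1 - x)"
    using l by (simp add: x_def scaleC_diff_right scaleC_scaleC scaleC_one)
  then have "((1 / l) *\<^sub>C b) * (l *\<^sub>C 1 - a) = 1" "(l *\<^sub>C 1 - a) * ((1 / l) *\<^sub>C b) = 1"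
    using b l by (simp_all add: mult_scaleC_left mult_scaleC_right scaleC_scaleC scaleC_one)
  then have "l \<notin> spectrum a" unfolding spectrum_iff by blast
  with assms show False by blast
qed

text \<open>
  If \<open>m - a\<close> has the inverse \<open>b\<close>, then \<open>l - a = (m - a) (1 - (m - l) b)\<close>, and the second factor is
  invertible when \<open>l\<close> is close to \<open>m\<close>.
\<close>

lemma closed_spectrum: "closed (spectrum a)"
proof -
  have "\<exists>e>0. ball m e \<subseteq> - spectrum a" if m: "m \<notin> spectrum a" for m
  proof -
    obtain b where b: "b * (m *\<^sub>C 1 - a) = 1" "(m *\<^sub>C 1 - a) * b = 1"
      using m unfolding spectrum_iff by blast
    have "l \<notin> spectrum a" if l: "dist m l < 1 / (norm b + 1)" for l
    proof -
      define d where "d = m *\<^sub>C 1 - a"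
      have "norm ((m - l) *\<^sub>C b) \<le> cmod (m - l) * (norm b + 1)"
        by (simp add: norm_scaleC mult_left_mono)
      also have "\<dots> < 1"
        using l norm_ge_zero [of b] by (simp add: dist_norm less_divide_eq)
      finally have "norm ((m - l) *\<^sub>C b) < 1" .
      then obtain c where c: "c * (1 - (m - l) *\<^sub>C b) = 1" "(1 - (m - l) *\<^sub>C b) * c = 1"
        by (rule neumann_inverse)
      have "l *\<^sub>C 1 - a = d - (m - l) *\<^sub>C 1"
        using scaleC_add_left [of l "m - l" "1 :: 'a"] by (simp add: d_def algebra_simps)
      then have f: "l *\<^sub>C 1 - a = d * (1 - (m - l) *\<^sub>C b)"
        using b by (simp add: d_def right_diff_distrib mult_scaleC_right)
      have "(c * b) * (l *\<^sub>C 1 - a) = c * ((b * d) * (1 - (m - l) *\<^sub>C b))"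
        unfolding f by (simp only: mult.assoc)
      also have "\<dots> = 1" using b c by (simp add: d_def)
      finally have 1: "(c * b) * (l *\<^sub>C 1 - a) = 1" .
      have "(l *\<^sub>C 1 - a) * (c * b) = d * (((1 - (m - l) *\<^sub>C b) * c) * b)"
        unfolding f by (simp only: mult.assoc)
      also have "\<dots> = 1" using b c by (simp add: d_def)
      finally show ?thesis using 1 unfolding spectrum_iff by blast
    qed
    moreover have "0 < 1 / (norm b + 1)" using norm_ge_zero [of b] by (simp add: add_nonneg_pos)
    ultimately show ?thesis by (intro exI [of _ "1 / (norm b + 1)"]) auto
  qed
  then show ?thesis unfolding closed_def open_contains_ball by blast
qed

lemma compact_spectrum: "compact (spectrum a)"
  unfolding compact_eq_bounded_closed
  using closed_spectrum cmod_le_norm_if_in_spectrum boundedI by blast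


section \<open>The functional calculus is isometric\<close>

lemma star_subalgebra_cont_funs: "star_subalgebra (cont_funs K)"
  unfolding star_subalgebra_def cont_funs_def
  by (auto simp: plus_fun_def times_fun_def zero_fun_def scaleC_fun_def star_fun_def
      scaleC_complex_def star_complex_def intro!: continuous_intros)

lemma cont_funs_closed:
  assumes "f \<in> cont_funs K"
  shows "g \<in> cont_funs K \<Longrightarrow> f + g \<in> cont_funs K"
    and "g \<in> cont_funs K \<Longrightarrow> f * g \<in> cont_funs K"
    and "c *\<^sub>C f \<in> cont_funs K" and "star f \<in> cont_funs K"
    and "g \<in> cont_funs K \<Longrightarrow> f - g \<in> cont_funs K"
proof -
  show "f - g \<in> cont_funs K" if "g \<in> cont_funs K"
    using that assms unfolding cont_funs_def by (auto intro!: continuous_intros simp: fun_diff_def)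
qed (use assms star_subalgebra_cont_funs [of K] in \<open>auto simp: star_subalgebra_def\<close>)

definition restrict_zero :: "complex set \<Rightarrow> (complex \<Rightarrow> complex) \<Rightarrow> complex \<Rightarrow> complex" where
  "restrict_zero K f z = (if z \<in> K then f z else 0)"

lemma restrict_zero_in_cont_funs:
  "continuous_on K f \<Longrightarrow> restrict_zero K f \<in> cont_funs K"
  by (auto simp: cont_funs_def restrict_zero_def cong: continuous_on_cong)

lemma const_one_on_eq: "const_one_on K = restrict_zero K (\<lambda>_. 1)"
  by (simp add: fun_eq_iff const_one_on_def restrict_zero_def)

lemma identity_on_eq: "identity_on K = restrict_zero K (\<lambda>z. z)"
  by (simp add: fun_eq_iff identity_on_def restrict_zero_def)

lemma const_one_on_in_cont_funs [simp]: "const_one_on K \<in> cont_funs K"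
  unfolding const_one_on_eq by (intro restrict_zero_in_cont_funs continuous_intros)

lemma identity_on_in_cont_funs [simp]: "identity_on K \<in> cont_funs K"
  unfolding identity_on_eq by (intro restrict_zero_in_cont_funs continuous_intros)

lemmas fun_ops = plus_fun_def times_fun_def zero_fun_def scaleC_fun_def star_fun_def
  scaleC_complex_def star_complex_def fun_diff_def

locale functional_calculus =
  fixes a :: "'a::unital_cstar_algebra" and \<Phi> :: "(complex \<Rightarrow> complex) \<Rightarrow> 'a"
  assumes calculus: "continuous_functional_calculus a \<Phi>"
begin

abbreviation "K \<equiv> spectrum a"

lemma hom: "star_hom (cont_funs K) UNIV \<Phi>"
  and map_one: "\<Phi> (const_one_on K) = 1"
  and map_identity: "\<Phi> (identity_on K) = a"
  using calculus unfolding continuous_functional_calculus_def by auto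

lemma map_add: "f \<in> cont_funs K \<Longrightarrow> g \<in> cont_funs K \<Longrightarrow> \<Phi> (f + g) = \<Phi> f + \<Phi> g"
  and map_mult: "f \<in> cont_funs K \<Longrightarrow> g \<in> cont_funs K \<Longrightarrow> \<Phi> (f * g) = \<Phi> f * \<Phi> g"
  and map_scaleC: "f \<in> cont_funs K \<Longrightarrow> \<Phi> (c *\<^sub>C f) = c *\<^sub>C \<Phi> f"
  and map_star: "f \<in> cont_funs K \<Longrightarrow> \<Phi> (star f) = star (\<Phi> f)"
  using hom unfolding star_hom_def by auto

lemma map_diff: "f \<in> cont_funs K \<Longrightarrow> g \<in> cont_funs K \<Longrightarrow> \<Phi> (f - g) = \<Phi> f - \<Phi> g"
  using map_add [of "f - g" g] cont_funs_closed(5) [of f K g] by simp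

lemma map_zero: "\<Phi> 0 = 0"
  using map_diff [of "const_one_on K" "const_one_on K"] by simp

text \<open>
  With \<open>w = h + i \<surd>(1 - h\<^sup>2)\<close>, the function \<open>h\<close> is the mean of \<open>w\<close> and its conjugate. Since \<open>w\<close> is
  unitary in \<open>C(K)\<close>, its image is unitary and has norm at most \<open>1\<close>. This uses that \<open>\<Phi>\<close> is defined
  on all continuous functions and avoids the spectral radius.
\<close>

lemma norm_map_real_le:
  assumes h: "h \<in> cont_funs K" and real: "\<And>z. z \<in> K \<Longrightarrow> h z = complex_of_real (Re (h z))"
    and le: "\<And>z. z \<in> K \<Longrightarrow> \<bar>Re (h z)\<bar> \<le> 1"
  shows "norm (\<Phi> h) \<le> 1"
proof -
  define w where "w = restrict_zero K (\<lambda>z. Complex (Re (h z)) (sqrt (1 - (Re (h z))\<^sup>2)))"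
  have w: "w \<in> cont_funs K"
    unfolding w_def Complex_eq using h
    by (intro restrict_zero_in_cont_funs continuous_intros) (simp_all add: cont_funs_def)
  have le': "(Re (h z))\<^sup>2 \<le> 1" if "z \<in> K" for z
    using le [OF that] by (simp add: abs_square_le_1)
  have "star w * w = const_one_on K"
  proof
    fix z
    show "(star w * w) z = const_one_on K z"
      using le' [of z] by (auto simp: fun_ops w_def restrict_zero_def const_one_on_def
          complex_eq_iff power2_eq_square)
  qed
  then have "star (\<Phi> w) * \<Phi> w = 1"
    using map_mult [of "star w" w] map_star [of w] w map_one cont_funs_closed(4) [OF w] by simp
  then have "(norm (\<Phi> w))\<^sup>2 \<le> 1" using cstar_identity [of "\<Phi> w"] norm_one_le by metis
  then have nw: "norm (\<Phi> w) \<le> 1" by (simp add: abs_square_le_1 [of "norm (\<Phi> w)", simplified])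
  have "h = (1/2) *\<^sub>C (w + star w)"
  proof
    fix z
    show "h z = ((1/2) *\<^sub>C (w + star w)) z"
      using h real [of z]
      by (auto simp: fun_ops w_def restrict_zero_def cont_funs_def complex_eq_iff)
  qed
  then have "\<Phi> h = (1/2) *\<^sub>C (\<Phi> w + star (\<Phi> w))"
    using w by (simp add: map_add map_scaleC map_star cont_funs_closed)
  then have "norm (\<Phi> h) \<le> (1/2) * (norm (\<Phi> w) + norm (star (\<Phi> w)))"
    using norm_triangle_ineq [of "\<Phi> w" "star (\<Phi> w)"] by (simp add: norm_scaleC)
  with nw show ?thesis by simp
qed

text \<open>
  The real case applies to \<open>|f|\<^sup>2 / r\<^sup>2\<close>, whose image has norm \<open>\<parallel>\<Phi> f\<parallel>\<^sup>2 / r\<^sup>2\<close> by the C*-identity.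
\<close>

lemma norm_map_le:
  assumes f: "f \<in> cont_funs K" and "M \<ge> 0" and le: "\<And>z. z \<in> K \<Longrightarrow> cmod (f z) \<le> M"
  shows "norm (\<Phi> f) \<le> M"
proof -
  have pos: "norm (\<Phi> f) \<le> r" if "r > 0" and r: "\<And>z. z \<in> K \<Longrightarrow> cmod (f z) \<le> r" for r
  proof -
    define h where "h = complex_of_real (1 / r\<^sup>2) *\<^sub>C (star f * f)"
    have h: "h \<in> cont_funs K" using f by (simp add: h_def cont_funs_closed)
    have hz: "h z = complex_of_real ((cmod (f z) / r)\<^sup>2)" for z
      by (simp add: h_def fun_ops mult.commute [of "cnj (f z)"] complex_norm_square [symmetric]
          power_divide del: of_real_power)
    have "norm (\<Phi> h) \<le> 1"
    proof (rule norm_map_real_le [OF h])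
      show "h z = complex_of_real (Re (h z))" for z by (simp add: hz)
      show "\<bar>Re (h z)\<bar> \<le> 1" if "z \<in> K" for z
        using r [OF that] \<open>r > 0\<close> by (simp add: hz power_le_one)
    qed
    moreover have "norm (\<Phi> h) = (norm (\<Phi> f) / r)\<^sup>2"
      using f by (simp add: h_def map_scaleC map_mult map_star cont_funs_closed norm_scaleC
          cstar_identity power_divide norm_divide norm_power)
    ultimately have "norm (\<Phi> f) / r \<le> 1"
      using abs_square_le_1 [of "norm (\<Phi> f) / r"] \<open>r > 0\<close> by simp
    with \<open>r > 0\<close> show ?thesis by (simp add: divide_le_eq)
  qed
  (* For M = 0 the scaling above is impossible. *)
  show ?thesis
  proof (rule field_le_epsilon)
    fix e :: real assume "e > 0"
    then show "norm (\<Phi> f) \<le> M + e" using \<open>M \<ge> 0\<close> le by (intro pos) force+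
  qed
qed

text \<open>
  Suppose \<open>\<parallel>\<Phi> f\<parallel> < c < |f w|\<close>, and let \<open>h\<close> be a bump function around \<open>w\<close>, supported where \<open>|f| > c\<close>.
  Some \<open>q\<close> with \<open>|q| \<le> 1/c\<close> inverts \<open>f\<close> on the support of \<open>h\<close>, so that \<open>h = h q f\<close> and
  \<open>\<parallel>\<Phi> h\<parallel> \<le> \<parallel>\<Phi> h\<parallel> \<parallel>\<Phi> f\<parallel> / c\<close>, whence \<open>\<Phi> h = 0\<close>. As \<open>1 - h\<close> vanishes near \<open>w\<close>, it is a multiple
  \<open>k (w - z)\<close> in \<open>C(K)\<close>, and applying \<open>\<Phi>\<close> shows that \<open>\<Phi> k\<close> inverts \<open>w - a\<close>.
\<close>

lemma cmod_le_norm_map: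
  assumes f: "f \<in> cont_funs K" and w: "w \<in> K"
  shows "cmod (f w) \<le> norm (\<Phi> f)"
proof (rule ccontr)
  assume "\<not> cmod (f w) \<le> norm (\<Phi> f)"
  then obtain c where c: "norm (\<Phi> f) < c" "c < cmod (f w)" using dense not_le by blast
  have "c > 0" using c(1) norm_ge_zero [of "\<Phi> f"] by linarith
  have cont: "continuous_on K f" using f by (simp add: cont_funs_def)
  obtain d where d: "d > 0" "\<And>z. z \<in> K \<Longrightarrow> dist z w < d \<Longrightarrow> dist (f z) (f w) < cmod (f w) - c"
    using cont w c(2) unfolding continuous_on_iff
    by (meson diff_gt_0_iff_gt)
  have large: "c < cmod (f z)" if "z \<in> K" "dist z w < d" for z
    using d(2) [OF that] norm_triangle_ineq2 [of "f w" "f w - f z"]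
    by (simp add: dist_norm norm_minus_commute)
  define \<beta> where "\<beta> z = max 0 (min 1 (2 - 2 * dist z w / d))" for z
  have \<beta>_cont: "continuous_on K (\<lambda>z. complex_of_real (\<beta> z))"
    unfolding \<beta>_def using d(1) by (intro continuous_intros) auto
  have \<beta>_far: "\<beta> z = 0" if "dist z w \<ge> d" for z
    using that d(1) by (simp add: \<beta>_def field_simps)
  have \<beta>_near: "\<beta> z = 1" if "dist z w \<le> d / 2" for z
    using that d(1) by (simp add: \<beta>_def field_simps)
  define h where "h = restrict_zero K (\<lambda>z. complex_of_real (\<beta> z))"
  have h: "h \<in> cont_funs K" unfolding h_def by (rule restrict_zero_in_cont_funs [OF \<beta>_cont])
  (* The maximum replaces |f z|^2 where f is small, which keeps the quotient continuous and changes
     nothing on the support of h. The same device is used for k below. *)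
  define q where "q = restrict_zero K (\<lambda>z. cnj (f z) / complex_of_real (max (c\<^sup>2) ((cmod (f z))\<^sup>2)))"
  have max_pos: "max (c\<^sup>2) x > 0" for x using \<open>c > 0\<close> by (simp add: less_max_iff_disj)
  have q: "q \<in> cont_funs K"
    unfolding q_def using max_pos cont
    by (intro restrict_zero_in_cont_funs continuous_intros) (auto simp: less_imp_neq [symmetric])
  have "h * (q * f) = h"
  proof
    fix z
    show "(h * (q * f)) z = h z"
    proof (cases "z \<in> K \<and> dist z w < d")
      case True
      then have "c < cmod (f z)" using large by blast
      then have "c\<^sup>2 \<le> (cmod (f z))\<^sup>2" "f z \<noteq> 0" using \<open>c > 0\<close> by (auto intro: power_mono)
      then have "q z * f z = 1"
        using True by (simp add: q_def restrict_zero_def max_absorb2 mult.commute [of "cnj (f z)"]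
            complex_norm_square del: of_real_power)
      then show ?thesis by (simp add: times_fun_def)
    qed (auto simp: h_def restrict_zero_def times_fun_def \<beta>_far not_less)
  qed
  then have "\<Phi> h = \<Phi> h * (\<Phi> q * \<Phi> f)"
    using map_mult [of h "q * f"] map_mult [of q f] cont_funs_closed(2) [of q K f] h q f by simp
  then have "norm (\<Phi> h) \<le> norm (\<Phi> h) * norm (\<Phi> q * \<Phi> f)"
    using norm_mult_ineq [of "\<Phi> h" "\<Phi> q * \<Phi> f"] by simp
  also have "\<dots> \<le> norm (\<Phi> h) * (norm (\<Phi> q) * norm (\<Phi> f))"
    by (intro mult_left_mono norm_mult_ineq norm_ge_zero)
  finally have "norm (\<Phi> h) \<le> norm (\<Phi> h) * (norm (\<Phi> q) * norm (\<Phi> f))" .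
  moreover have "norm (\<Phi> q) \<le> 1 / c"
  proof (rule norm_map_le [OF q])
    show "cmod (q z) \<le> 1 / c" if "z \<in> K" for z
    proof -
      have "cmod (q z) = cmod (f z) / max (c\<^sup>2) ((cmod (f z))\<^sup>2)"
        using that max_pos [of "(cmod (f z))\<^sup>2"]
        by (simp only: q_def restrict_zero_def norm_divide norm_of_real if_True complex_mod_cnj abs_of_pos)
      moreover have "cmod (f z) * c \<le> max (c\<^sup>2) ((cmod (f z))\<^sup>2)"
      proof (cases "c \<le> cmod (f z)")
        case True
        then have "cmod (f z) * c \<le> (cmod (f z))\<^sup>2" unfolding power2_eq_square by (intro mult_left_mono) auto
        then show ?thesis by simp
      next
        case False
        then have "cmod (f z) * c \<le> c\<^sup>2"
          unfolding power2_eq_square using \<open>c > 0\<close> by (intro mult_right_mono) auto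
        then show ?thesis by simp
      qed
      ultimately show ?thesis
        using max_pos [of "(cmod (f z))\<^sup>2"] \<open>c > 0\<close> by (simp add: pos_divide_le_eq pos_le_divide_eq)
    qed
  qed (use \<open>c > 0\<close> in simp)
  then have "norm (\<Phi> q) * norm (\<Phi> f) \<le> norm (\<Phi> f) / c"
    using mult_right_mono [of "norm (\<Phi> q)" "1 / c" "norm (\<Phi> f)"] by simp
  moreover have "norm (\<Phi> f) / c < 1" using c(1) \<open>c > 0\<close> by simp
  ultimately have h0: "\<Phi> h = 0"
    by (auto simp: mult_le_cancel_left1)
  define k where "k = restrict_zero K (\<lambda>z. (1 - complex_of_real (\<beta> z)) * cnj (w - z) /
    complex_of_real (max ((d / 2)\<^sup>2) ((cmod (w - z))\<^sup>2)))"
  have max_pos: "max ((d / 2)\<^sup>2) x > 0" for x using \<open>d > 0\<close> by (simp add: less_max_iff_disj)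
  have k: "k \<in> cont_funs K"
    unfolding k_def using max_pos \<beta>_cont
    by (intro restrict_zero_in_cont_funs continuous_intros) (auto simp: less_imp_neq [symmetric])
  define l where "l = w *\<^sub>C const_one_on K - identity_on K"
  have l: "l \<in> cont_funs K" by (simp add: l_def cont_funs_closed)
  have \<Phi>l: "\<Phi> l = w *\<^sub>C 1 - a"
    by (simp add: l_def map_diff cont_funs_closed map_scaleC map_one map_identity)
  have kl: "k * l = const_one_on K - h"
  proof
    fix z
    show "(k * l) z = (const_one_on K - h) z"
    proof (cases "z \<in> K \<and> dist z w > d / 2")
      case True
      then have "(d / 2)\<^sup>2 \<le> (cmod (w - z))\<^sup>2" "w \<noteq> z"
        using d(1) by (auto intro!: power_mono simp: dist_norm norm_minus_commute)
      then have "cnj (w - z) / complex_of_real (max ((d / 2)\<^sup>2) ((cmod (w - z))\<^sup>2)) * (w - z) = 1"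
        by (simp add: max_absorb2 mult.commute [of "cnj w - cnj z"] complex_norm_square
            del: of_real_power)
      then have "(1 - complex_of_real (\<beta> z)) * (cnj (w - z) /
          complex_of_real (max ((d / 2)\<^sup>2) ((cmod (w - z))\<^sup>2)) * (w - z)) = 1 - complex_of_real (\<beta> z)"
        by simp
      then show ?thesis
        using True by (simp add: fun_ops k_def l_def h_def restrict_zero_def const_one_on_def
            identity_on_def mult.assoc)
    qed (auto simp: fun_ops k_def l_def h_def restrict_zero_def const_one_on_def \<beta>_near not_less)
  qed
  moreover have "l * k = k * l" by (simp add: fun_eq_iff times_fun_def mult.commute)
  moreover have "\<Phi> (const_one_on K - h) = 1" using h h0 by (simp add: map_diff map_one)
  ultimately have "\<Phi> k * (w *\<^sub>C 1 - a) = 1" "(w *\<^sub>C 1 - a) * \<Phi> k = 1"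
    using map_mult [of k l] map_mult [of l k] k l \<Phi>l by simp_all
  with w show False unfolding spectrum_def by blast
qed

lemma norm_map: "f \<in> cont_funs K \<Longrightarrow> norm (\<Phi> f) = sup_norm K f"
proof (rule antisym)
  assume f: "f \<in> cont_funs K"
  have bdd: "bdd_above (insert 0 ((\<lambda>z. cmod (f z)) ` K))"
    using cmod_le_norm_map [OF f] by (auto simp: bdd_above_def intro!: exI [of _ "norm (\<Phi> f)"])
  show "norm (\<Phi> f) \<le> sup_norm K f"
    unfolding sup_norm_def by (intro norm_map_le [OF f] cSup_upper [OF _ bdd]) auto
  show "sup_norm K f \<le> norm (\<Phi> f)"
    unfolding sup_norm_def using cmod_le_norm_map [OF f] by (intro cSup_least) auto
qed

end


section \<open>Generated subalgebras and the range of the functional calculus\<close>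

lemma star_subalgebra_hull: "star_subalgebra (star_subalgebra hull X)"
  by (rule hull_in) (auto simp: star_subalgebra_def)

lemma star_subalgebra_cstar_generated: "star_subalgebra (cstar_generated X)"
  and closed_cstar_generated: "closed (cstar_generated X)"
proof -
  have "star_subalgebra (cstar_generated X) \<and> closed (cstar_generated X)"
    unfolding cstar_generated_def
    by (rule hull_in) (auto simp: star_subalgebra_def intro!: closed_Inter)
  then show "star_subalgebra (cstar_generated X)" "closed (cstar_generated X)" by auto
qed

lemma star_subalgebra_scaleC: "star_subalgebra S \<Longrightarrow> x \<in> S \<Longrightarrow> c *\<^sub>C x \<in> S"
  and star_subalgebra_add: "star_subalgebra S \<Longrightarrow> x \<in> S \<Longrightarrow> y \<in> S \<Longrightarrow> x + y \<in> S"
  and star_subalgebra_mult: "star_subalgebra S \<Longrightarrow> x \<in> S \<Longrightarrow> y \<in> S \<Longrightarrow> x * y \<in> S"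
  and star_subalgebra_star: "star_subalgebra S \<Longrightarrow> x \<in> S \<Longrightarrow> star x \<in> S"
  and star_subalgebra_zero: "star_subalgebra S \<Longrightarrow> 0 \<in> S"
  by (auto simp: star_subalgebra_def)

lemma bounded_linear_scaleC: "bounded_linear (\<lambda>x :: 'a::cstar_algebra. c *\<^sub>C x)"
  by (rule bounded_linear_intro [where K = "cmod c"])
    (auto simp: scaleC_add_right scaleR_scaleC scaleC_scaleC norm_scaleC mult.commute)

lemma bounded_linear_star: "bounded_linear (star :: 'a::cstar_algebra \<Rightarrow> 'a)"
  by (rule bounded_linear_intro [where K = 1]) (auto simp: star_add scaleR_scaleC star_scaleC)

lemma star_subalgebra_closure:
  fixes S :: "'a::cstar_algebra set"
  assumes "star_subalgebra S"
  shows "star_subalgebra (closure S)"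
  unfolding star_subalgebra_def
proof (intro conjI ballI allI)
  show "0 \<in> closure S" using assms closure_subset star_subalgebra_zero by blast
next
  fix x y assume "x \<in> closure S" "y \<in> closure S"
  then obtain X Y where X: "\<And>n. X n \<in> S" "X \<longlonglongrightarrow> x" and Y: "\<And>n. Y n \<in> S" "Y \<longlonglongrightarrow> y"
    unfolding closure_sequential by blast
  show "x + y \<in> closure S"
    unfolding closure_sequential using X Y star_subalgebra_add [OF assms]
    by (intro exI [of _ "\<lambda>n. X n + Y n"]) (auto intro: tendsto_add)
  show "x * y \<in> closure S"
    unfolding closure_sequential using X Y star_subalgebra_mult [OF assms]
    by (intro exI [of _ "\<lambda>n. X n * Y n"]) (auto intro: tendsto_mult)
next
  fix c x assume "x \<in> closure S"
  then obtain X where X: "\<And>n. X n \<in> S" "X \<longlonglongrightarrow> x" unfolding closure_sequential by blast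
  show "c *\<^sub>C x \<in> closure S"
    unfolding closure_sequential using X star_subalgebra_scaleC [OF assms]
    by (intro exI [of _ "\<lambda>n. c *\<^sub>C X n"]) (auto intro: bounded_linear.tendsto [OF bounded_linear_scaleC])
next
  fix x assume "x \<in> closure S"
  then obtain X where X: "\<And>n. X n \<in> S" "X \<longlonglongrightarrow> x" unfolding closure_sequential by blast
  show "star x \<in> closure S"
    unfolding closure_sequential using X star_subalgebra_star [OF assms]
    by (intro exI [of _ "\<lambda>n. star (X n)"]) (auto intro: bounded_linear.tendsto [OF bounded_linear_star])
qed

text \<open>
  The closure of a star subalgebra is again one, so it already contains everything generated.
\<close>

lemma cstar_generated_subset_closure: "cstar_generated X \<subseteq> closure (star_subalgebra hull X)"
  unfolding cstar_generated_def
proof (rule hull_minimal)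
  show "X \<subseteq> closure (star_subalgebra hull X)"
    using hull_subset closure_subset by (rule order_trans)
qed (simp add: star_subalgebra_closure star_subalgebra_hull)

lemma subset_cstar_generated: "X \<subseteq> cstar_generated X"
  unfolding cstar_generated_def by (rule hull_subset)

lemma star_hom_poly_value:
  assumes S: "star_subalgebra S" and F: "star_hom S T F" and s: "\<And>i. s i \<in> S"
  shows "poly_value s P \<in> S \<and> F (poly_value s P) = poly_value (\<lambda>i. F (s i)) P"
proof -
  have F0: "F 0 = 0"
  proof -
    have "F (0 + 0) = F 0 + F 0"
      using F star_subalgebra_zero [OF S] unfolding star_hom_def by blast
    then show ?thesis by simp
  qed
  have var: "var_value s v \<in> S \<and> F (var_value s v) = var_value (\<lambda>i. F (s i)) v" for v
    using s F star_subalgebra_star [OF S] by (cases v) (auto simp: star_hom_def)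
  have "monomial_value s (v, vs) \<in> S \<and>
      F (monomial_value s (v, vs)) = monomial_value (\<lambda>i. F (s i)) (v, vs)" for v vs
    by (induction vs rule: rev_induct)
      (use var F star_subalgebra_mult [OF S] in \<open>auto simp: monomial_value_def star_hom_def\<close>)
  then have mono: "monomial_value s m \<in> S \<and>
      F (monomial_value s m) = monomial_value (\<lambda>i. F (s i)) m" for m
    by (cases m) auto
  show ?thesis
  proof (induction P)
    case Nil
    show ?case using F0 star_subalgebra_zero [OF S] by simp
  next
    case (Cons t P)
    let ?c = "Complex (of_rat (fst (fst t))) (of_rat (snd (fst t)))"
    have "?c *\<^sub>C monomial_value s (snd t) \<in> S" using mono star_subalgebra_scaleC [OF S] by blast
    then show ?case
      using Cons mono [of "snd t"] F star_subalgebra_add [OF S]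
      by (simp add: poly_value_Cons star_hom_def)
  qed
qed

lemma special_points_standard_C:
  "special_points (standard_presentation_C K) = {const_one_on K, identity_on K}"
  and special_points_standard_cstar:
  "special_points (standard_presentation_cstar a) = {1, a}"
proof -
  have two: "enat i < 2 \<longleftrightarrow> i = 0 \<or> i = 1" for i
    using enat_ord_simps(2) [of i 2] by (auto simp flip: numeral_eq_enat)
  show "special_points (standard_presentation_C K) = {const_one_on K, identity_on K}"
    unfolding special_points_def standard_presentation_C_def by (auto simp: two)
  show "special_points (standard_presentation_cstar a) = {1, a}"
    unfolding special_points_def standard_presentation_cstar_def by (auto simp: two)
qed

lemma presentation_standard_cstar: "presentation (standard_presentation_cstar a)"
proof -
  have "\<exists>y\<in>star_subalgebra hull {1, a}. norm (x - y) < \<epsilon>"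
    if "x \<in> cstar_generated {1, a}" "\<epsilon> > 0" for x and \<epsilon> :: real
    using that cstar_generated_subset_closure [of "{1, a}"]
    by (metis closure_approachable dist_norm norm_minus_commute subsetD)
  then show ?thesis
    using star_subalgebra_cstar_generated [of "{1, a}"] subset_cstar_generated [of "{1, a}"]
    unfolding presentation_def special_points_standard_cstar
    by (simp add: standard_presentation_cstar_def)
qed

lemma sup_norm_le:
  assumes "M \<ge> 0" "\<And>z. z \<in> K \<Longrightarrow> cmod (f z) \<le> M"
  shows "sup_norm K f \<le> M"
  unfolding sup_norm_def by (rule cSup_least) (use assms in auto)

text \<open>
  A real linear form on the plane is \<open>z \<mapsto> \<alpha> z + cnj \<alpha> cnj z\<close> for some \<open>\<alpha>\<close>, so real polynomials in the
  coordinates are polynomials in \<open>z\<close> and its conjugate.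
\<close>

lemma real_polynomial_in_hull:
  assumes "real_polynomial_function p"
  shows "restrict_zero K (\<lambda>z. complex_of_real (p z)) \<in>
    star_subalgebra hull {const_one_on K, identity_on K}" (is "_ \<in> ?S")
  using assms
proof induction
  case (linear f)
  define u v where "u = f 1" and "v = f \<i>"
  define \<alpha> where "\<alpha> = Complex (u / 2) (- v / 2)"
  have "f z = Re z * u + Im z * v" for z
  proof -
    interpret bounded_linear f by fact
    have "z = Re z *\<^sub>R 1 + Im z *\<^sub>R \<i>" by (simp add: complex_eq_iff)
    then have "f z = f (Re z *\<^sub>R 1 + Im z *\<^sub>R \<i>)" by (rule arg_cong)
    also have "\<dots> = Re z * u + Im z * v" by (simp only: add scaleR real_scaleR_def u_def v_def)
    finally show ?thesis .
  qed
  then have "restrict_zero K (\<lambda>z. complex_of_real (f z)) =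
      \<alpha> *\<^sub>C identity_on K + cnj \<alpha> *\<^sub>C star (identity_on K)"
    by (auto simp: fun_eq_iff fun_ops restrict_zero_def identity_on_def complex_eq_iff \<alpha>_def)
  moreover have "identity_on K \<in> ?S" by (simp add: hull_inc)
  ultimately show ?case
    by (simp only:) (intro star_subalgebra_add star_subalgebra_scaleC star_subalgebra_star
        star_subalgebra_hull)
next
  case (const c)
  have "restrict_zero K (\<lambda>z. complex_of_real c) = complex_of_real c *\<^sub>C const_one_on K"
    by (auto simp: fun_eq_iff fun_ops restrict_zero_def const_one_on_def)
  then show ?case
    by (simp only:) (intro star_subalgebra_scaleC star_subalgebra_hull hull_inc insertI1)
next
  case (add f g)
  have "restrict_zero K (\<lambda>z. complex_of_real (f z + g z)) =
      restrict_zero K (\<lambda>z. complex_of_real (f z)) + restrict_zero K (\<lambda>z. complex_of_real (g z))"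
    by (auto simp: fun_eq_iff fun_ops restrict_zero_def)
  then show ?case
    using add.IH by (simp only:) (intro star_subalgebra_add star_subalgebra_hull)
next
  case (mult f g)
  have "restrict_zero K (\<lambda>z. complex_of_real (f z * g z)) =
      restrict_zero K (\<lambda>z. complex_of_real (f z)) * restrict_zero K (\<lambda>z. complex_of_real (g z))"
    by (auto simp: fun_eq_iff fun_ops restrict_zero_def)
  then show ?case
    using mult.IH by (simp only:) (intro star_subalgebra_mult star_subalgebra_hull)
qed

lemma presentation_standard_C:
  assumes "compact K"
  shows "presentation (standard_presentation_C K)"
proof -
  let ?S = "star_subalgebra hull {const_one_on K, identity_on K}"
  have "\<exists>g\<in>?S. sup_norm K (f - g) < \<epsilon>" if f: "f \<in> cont_funs K" and "\<epsilon> > 0" for f and \<epsilon> :: real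
  proof -
    have "continuous_on K f" using f by (simp add: cont_funs_def)
    then have cont: "continuous_on K (\<lambda>z. Re (f z))" "continuous_on K (\<lambda>z. Im (f z))"
      by (rule continuous_on_Re, rule continuous_on_Im)
    have \<epsilon>: "\<epsilon> / 3 > 0" using \<open>\<epsilon> > 0\<close> by simp
    obtain p where p: "real_polynomial_function p" "\<And>z. z \<in> K \<Longrightarrow> \<bar>Re (f z) - p z\<bar> < \<epsilon> / 3"
      using Stone_Weierstrass_real_polynomial_function [OF assms cont(1) \<epsilon>] by blast
    obtain q where q: "real_polynomial_function q" "\<And>z. z \<in> K \<Longrightarrow> \<bar>Im (f z) - q z\<bar> < \<epsilon> / 3"
      using Stone_Weierstrass_real_polynomial_function [OF assms cont(2) \<epsilon>] by blast
    define g where "g = restrict_zero K (\<lambda>z. complex_of_real (p z)) +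
      \<i> *\<^sub>C restrict_zero K (\<lambda>z. complex_of_real (q z))"
    have "g \<in> ?S"
      unfolding g_def using real_polynomial_in_hull [of p K] real_polynomial_in_hull [of q K] p(1) q(1)
      by (intro star_subalgebra_add [OF star_subalgebra_hull]
          star_subalgebra_scaleC [OF star_subalgebra_hull]) auto
    moreover have "sup_norm K (f - g) \<le> \<epsilon> / 3 + \<epsilon> / 3"
    proof (rule sup_norm_le)
      fix z assume "z \<in> K"
      then have "Re ((f - g) z) = Re (f z) - p z" "Im ((f - g) z) = Im (f z) - q z"
        by (simp_all add: g_def fun_ops restrict_zero_def)
      then show "cmod ((f - g) z) \<le> \<epsilon> / 3 + \<epsilon> / 3"
        using p(2) [OF \<open>z \<in> K\<close>] q(2) [OF \<open>z \<in> K\<close>] cmod_le [of "(f - g) z"] by simp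
    qed (use \<open>\<epsilon> > 0\<close> in simp)
    ultimately show ?thesis using \<open>\<epsilon> > 0\<close> by (intro bexI [of _ g]) auto
  qed
  then show ?thesis
    using star_subalgebra_cont_funs [of K]
    unfolding presentation_def special_points_standard_C
    by (simp add: standard_presentation_C_def)
qed

context functional_calculus
begin

text \<open>
  Polynomials are mapped into the generated algebra, which is closed, and they are dense.
\<close>

lemma map_in_cstar_generated:
  assumes f: "f \<in> cont_funs K"
  shows "\<Phi> f \<in> cstar_generated {1, a}"
proof -
  let ?S = "star_subalgebra hull {const_one_on K, identity_on K}"
  let ?G = "cstar_generated {1, a}"
  note G = star_subalgebra_cstar_generated [of "{1, a}"]
  have "star_subalgebra {f \<in> cont_funs K. \<Phi> f \<in> ?G}"
    using G star_subalgebra_cont_funs [of K] unfolding star_subalgebra_def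
    by (auto simp: map_zero map_add map_mult map_scaleC map_star)
  moreover have "{const_one_on K, identity_on K} \<subseteq> {f \<in> cont_funs K. \<Phi> f \<in> ?G}"
    using subset_cstar_generated [of "{1, a}"] by (auto simp: map_one map_identity)
  ultimately have S: "?S \<subseteq> {f \<in> cont_funs K. \<Phi> f \<in> ?G}" by (intro hull_minimal)
  have "\<exists>y\<in>?G. dist y (\<Phi> f) < \<epsilon>" if "\<epsilon> > 0" for \<epsilon>
  proof -
    have "\<forall>x\<in>cont_funs K. \<forall>\<epsilon>>0. \<exists>y\<in>?S. sup_norm K (x - y) < \<epsilon>"
      using presentation_standard_C [OF compact_spectrum, of a]
      unfolding presentation_def special_points_standard_C
      by (simp add: standard_presentation_C_def)
    with f that obtain g where g: "g \<in> ?S" "sup_norm K (f - g) < \<epsilon>" by blast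
    then have g': "g \<in> cont_funs K" "\<Phi> g \<in> ?G" using S by auto
    then have "dist (\<Phi> g) (\<Phi> f) = sup_norm K (f - g)"
      using norm_map [of "f - g"] f
      by (simp add: dist_norm norm_minus_commute map_diff cont_funs_closed)
    with g(2) have "dist (\<Phi> g) (\<Phi> f) < \<epsilon>" by simp
    with g'(2) show ?thesis by (rule rev_bexI)
  qed
  then show ?thesis
    using closed_cstar_generated [of "{1, a}"] closed_approachable by blast
qed

text \<open>
  Being isometric, \<open>\<Phi>\<close> pulls a convergent sequence in its range back to a uniform Cauchy sequence,
  whose limit is continuous on \<open>K\<close>.
\<close>

lemma closed_range: "closed (\<Phi> ` cont_funs K)"
  unfolding closed_sequential_limits
proof (intro allI impI, elim conjE)
  fix Y y assume "\<forall>n. Y n \<in> \<Phi> ` cont_funs K" and lim: "Y \<longlonglongrightarrow> y"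
  then obtain f where f: "\<And>n. f n \<in> cont_funs K" "\<And>n. Y n = \<Phi> (f n)"
    unfolding image_iff by metis
  have le: "dist (f m z) (f n z) \<le> dist (Y m) (Y n)" if "z \<in> K" for m n z
    using cmod_le_norm_map [of "f m - f n" z] f that
    by (simp add: dist_norm map_diff cont_funs_closed)
  have "uniformly_Cauchy_on K f"
  proof (rule uniformly_Cauchy_onI)
    fix e :: real assume "e > 0"
    then obtain M where "\<And>m n. m \<ge> M \<Longrightarrow> n \<ge> M \<Longrightarrow> dist (Y m) (Y n) < e"
      using LIMSEQ_imp_Cauchy [OF lim] unfolding Cauchy_def by blast
    then show "\<exists>M. \<forall>x\<in>K. \<forall>m\<ge>M. \<forall>n\<ge>M. dist (f m x) (f n x) < e"
      using le le_less_trans by blast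
  qed
  then obtain l where l: "uniform_limit K f l sequentially"
    using Cauchy_uniformly_convergent unfolding uniformly_convergent_on_def by blast
  have "continuous_on K l"
    by (rule uniform_limit_theorem [OF _ l]) (use f in \<open>auto simp: cont_funs_def\<close>)
  then have g: "restrict_zero K l \<in> cont_funs K" by (rule restrict_zero_in_cont_funs)
  have "Y \<longlonglongrightarrow> \<Phi> (restrict_zero K l)"
  proof (rule metric_LIMSEQ_I)
    fix e :: real assume "e > 0"
    then have "\<forall>\<^sub>F n in sequentially. \<forall>z\<in>K. dist (f n z) (l z) < e / 2"
      using l half_gt_zero unfolding uniform_limit_iff by blast
    then obtain M where M: "\<And>n z. n \<ge> M \<Longrightarrow> z \<in> K \<Longrightarrow> dist (f n z) (l z) < e / 2"
      unfolding eventually_sequentially by blast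
    have "dist (Y n) (\<Phi> (restrict_zero K l)) < e" if "n \<ge> M" for n
    proof -
      have "norm (\<Phi> (f n - restrict_zero K l)) \<le> e / 2"
      proof (rule norm_map_le)
        show "f n - restrict_zero K l \<in> cont_funs K" using f g by (simp add: cont_funs_closed)
        show "cmod ((f n - restrict_zero K l) z) \<le> e / 2" if "z \<in> K" for z
          using M [OF \<open>n \<ge> M\<close> that] that by (simp add: restrict_zero_def dist_norm less_imp_le)
      qed (use \<open>e > 0\<close> in simp)
      then show ?thesis using f g \<open>e > 0\<close> by (simp add: dist_norm map_diff)
    qed
    then show "\<exists>M. \<forall>n\<ge>M. dist (Y n) (\<Phi> (restrict_zero K l)) < e" by blast
  qed
  then have "y = \<Phi> (restrict_zero K l)" using lim LIMSEQ_unique by blast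
  with g show "y \<in> \<Phi> ` cont_funs K" by blast
qed

lemma star_iso: "star_iso (cont_funs K) (cstar_generated {1, a}) \<Phi>"
proof -
  have "inj_on \<Phi> (cont_funs K)"
  proof (rule inj_onI)
    fix f g assume f: "f \<in> cont_funs K" and g: "g \<in> cont_funs K" and "\<Phi> f = \<Phi> g"
    then have "cmod ((f - g) z) \<le> 0" if "z \<in> K" for z
      using cmod_le_norm_map [of "f - g" z] that by (simp add: map_diff cont_funs_closed)
    then have "f z = g z" if "z \<in> K" for z
      using that by (simp add: fun_diff_def)
    with f g show "f = g" by (force simp: cont_funs_def fun_eq_iff)
  qed
  moreover have "\<Phi> ` cont_funs K = cstar_generated {1, a}"
  proof
    have "star_subalgebra (\<Phi> ` cont_funs K)"
      unfolding star_subalgebra_def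
    proof (intro conjI ballI allI; (elim imageE)?)
      show "0 \<in> \<Phi> ` cont_funs K"
        using map_zero star_subalgebra_zero [OF star_subalgebra_cont_funs] by (metis image_eqI)
    qed (auto simp: cont_funs_closed simp flip: map_add map_mult map_star map_scaleC)
    moreover have "{1, a} \<subseteq> \<Phi> ` cont_funs K"
      by (metis const_one_on_in_cont_funs identity_on_in_cont_funs empty_subsetI image_eqI
          insert_subset map_identity map_one)
    ultimately show "cstar_generated {1, a} \<subseteq> \<Phi> ` cont_funs K"
      unfolding cstar_generated_def using closed_range by (intro hull_minimal) auto
  qed (use map_in_cstar_generated in blast)
  ultimately show ?thesis
    using hom map_in_cstar_generated unfolding star_iso_def bij_betw_def star_hom_def by auto
qed

section \<open>Computability of the functional calculus\<close>

lemma map_generated_point: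
  "generated_point (standard_presentation_C K) c \<in> cont_funs K"
  "\<Phi> (generated_point (standard_presentation_C K) c) =
    generated_point (standard_presentation_cstar a) c"
proof -
  let ?s = "\<lambda>i::nat. if i = 0 then const_one_on K else identity_on K"
  have "?s i \<in> cont_funs K" for i by simp
  moreover have "(\<lambda>i. \<Phi> (?s i)) = (\<lambda>i. if i = 0 then 1 else a)"
    by (auto simp: map_one map_identity)
  ultimately show "generated_point (standard_presentation_C K) c \<in> cont_funs K"
    "\<Phi> (generated_point (standard_presentation_C K) c) =
      generated_point (standard_presentation_cstar a) c"
    using star_hom_poly_value [OF star_subalgebra_cont_funs hom, of ?s "poly_decode c"]
    by (simp_all add: generated_point_def standard_presentation_C_def standard_presentation_cstar_def)
qed

lemma norm_map_diff_generated_point: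
  assumes "f \<in> cont_funs K"
  shows "norm (\<Phi> f - generated_point (standard_presentation_cstar a) c) =
    sup_norm K (f - generated_point (standard_presentation_C K) c)"
  using assms map_generated_point [of c] norm_map [of "f - generated_point (standard_presentation_C K) c"]
  by (simp add: map_diff cont_funs_closed)

text \<open>
  Codes have the same meaning on both sides and distances agree, so names can simply be copied.
\<close>

lemma is_name_map_iff:
  assumes "f \<in> cont_funs K"
  shows "is_name (standard_presentation_cstar a) (\<Phi> f) \<rho> \<longleftrightarrow>
    is_name (standard_presentation_C K) f \<rho>"
  using norm_map_diff_generated_point [OF assms]
  by (simp add: is_name_def is_code_def standard_presentation_C_def standard_presentation_cstar_def
      generated_point_def)

lemma computable_star_iso_standard:
  "computable_star_iso (standard_presentation_C K) (standard_presentation_cstar a) \<Phi>"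
proof -
  let ?C = "standard_presentation_C K" and ?A = "standard_presentation_cstar a"
  have C: "elements ?C = cont_funs K" and A: "elements ?A = cstar_generated {1, a}"
    by (simp_all add: standard_presentation_C_def standard_presentation_cstar_def)
  have pres: "presentation ?C" "presentation ?A"
    by (simp_all add: presentation_standard_C compact_spectrum presentation_standard_cstar)
  have bij: "bij_betw \<Phi> (cont_funs K) (cstar_generated {1, a})"
    using star_iso by (simp add: star_iso_def)
  have "\<exists>\<sigma>. (\<forall>k. oeval \<rho> Query [k] (\<sigma> k)) \<and> is_name ?A (\<Phi> f) \<sigma>"
    if "f \<in> cont_funs K" "is_name ?C f \<rho>" for f \<rho>
    using that oeval_Query is_name_map_iff by blast
  then have "computable_map ?C ?A \<Phi>"
    unfolding computable_map_def A C using pres map_in_cstar_generated by blast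
  moreover have "\<exists>\<sigma>. (\<forall>k. oeval \<rho> Query [k] (\<sigma> k)) \<and>
      is_name ?C (inv_into (cont_funs K) \<Phi> x) \<sigma>"
    if "x \<in> cstar_generated {1, a}" "is_name ?A x \<rho>" for x \<rho>
  proof -
    have "inv_into (cont_funs K) \<Phi> x \<in> cont_funs K" "\<Phi> (inv_into (cont_funs K) \<Phi> x) = x"
      using that(1) bij by (metis bij_betw_def inv_into_into) (metis bij_betw_inv_into_right that(1) bij)
    then show ?thesis using that(2) oeval_Query is_name_map_iff by metis
  qed
  then have "computable_map ?A ?C (inv_into (cont_funs K) \<Phi>)"
    unfolding computable_map_def A C using pres bij_betw_apply [OF bij_betw_inv_into [OF bij]]
    by blast
  ultimately show ?thesis
    unfolding computable_star_iso_def A C using star_iso by blast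
qed

end

theorem theorem3p3:
  fixes N :: enat and s :: "nat \<Rightarrow> 'a::unital_cstar_algebra" and a :: 'a
    and \<Phi> :: "(complex \<Rightarrow> complex) \<Rightarrow> 'a"
  assumes "separable_space (euclidean :: 'a topology)"
    and "computable_presentation (presented_by N s)"
    and "computably_unital (presented_by N s)"
    and "normal a"
    and "computable_point (presented_by N s) a"
    and "continuous_functional_calculus a \<Phi>"
  shows "computable_star_iso (standard_presentation_C (spectrum a))
           (standard_presentation_cstar a) \<Phi> \<and>
         computable_presentation (standard_presentation_C (spectrum a)) \<and>
         computable_map (standard_presentation_C (spectrum a)) (presented_by N s) \<Phi>"
proof (intro conjI)
  interpret functional_calculus a \<Phi> by standard fact
  let ?C = "standard_presentation_C K" and ?Q = "presented_by N s"
  show "computable_star_iso ?C (standard_presentation_cstar a) \<Phi>"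
    by (rule computable_star_iso_standard)
  have pres: "presentation ?C" by (intro presentation_standard_C compact_spectrum)
  have presQ: "presentation ?Q" using assms(2) by (simp add: computable_presentation_def)
  have C: "elements ?C = cont_funs K" "norm_of ?C = sup_norm K"
    by (simp_all add: standard_presentation_C_def)
  have Q: "elements ?Q = UNIV" "norm_of ?Q = norm" by (simp_all add: presented_by_def)
  obtain g where g: "computable2 g" "\<And>c k. is_code ?Q (g c k)"
    "\<And>c k. norm (poly_value (\<lambda>i. if i = 0 then 1 else a) (poly_decode c) -
              generated_point ?Q (g c k)) < 1 / 2 ^ k"
    using computable_evaluation [of N s 1 a] assms(3,5) unfolding computably_unital_def by blast
  have near: "norm (\<Phi> (generated_point ?C c) - generated_point ?Q (g c k)) < 1 / 2 ^ k" for c k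
    using g(3) [of c k] unfolding map_generated_point(2)
    unfolding generated_point_def [of "standard_presentation_cstar a"]
    by (simp add: standard_presentation_cstar_def)
  obtain eg where eg: "\<And>orc c k. oeval orc eg [c, k] (g c k)"
    using g(1) unfolding computable2_def total_computable_def
    by (metis length_Cons list.size(3) nth_Cons_0 nth_Cons_Suc numeral_2_eq_2 One_nat_def)
  obtain esuc where esuc: "\<And>orc xs. length xs = 2 \<Longrightarrow> oeval orc esuc xs (Suc (xs ! 1))"
    using total_computable_Suc [OF total_computable_proj [of 1 2]]
    unfolding total_computable_def by auto

  show "computable_presentation ?C"
  proof -
    obtain e where e: "\<And>c k. is_code ?Q c \<Longrightarrow> \<exists>r. computes e [c, k] r \<and>
        \<bar>norm (generated_point ?Q c) - of_rat (rat_decode r)\<bar> < 1 / 2 ^ k"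
      using assms(2) unfolding computable_presentation_def Q by blast
    (* Half of the error is spent on approximating the point, half on its norm. *)
    let ?e = "Comp e [Comp eg [Proj 0, esuc], esuc]"
    have "\<exists>r. computes ?e [c, k] r \<and>
        \<bar>norm_of ?C (generated_point ?C c) - of_rat (rat_decode r)\<bar> < 1 / 2 ^ k" for c k
    proof -
      obtain r where r: "computes e [g c (Suc k), Suc k] r"
        "\<bar>norm (generated_point ?Q (g c (Suc k))) - of_rat (rat_decode r)\<bar> < 1 / 2 ^ Suc k"
        using e g(2) by blast
      have suc: "computes esuc [c, k] (Suc k)" using esuc [of "[c, k]"] by simp
      have "computes (Comp eg [Proj 0, esuc]) [c, k] (g c (Suc k))"
        by (rule oeval_Comp [where ys = "[c, Suc k]"])
          (use suc eg oeval_Proj [of 0 "[c, k]"] in \<open>auto simp: less_Suc_eq\<close>)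
      then have "computes ?e [c, k] r"
        by (intro oeval_Comp [where ys = "[g c (Suc k), Suc k]"])
          (use suc r(1) in \<open>auto simp: less_Suc_eq\<close>)
      moreover have "norm_of ?C (generated_point ?C c) = norm (\<Phi> (generated_point ?C c))"
        by (simp only: C(2) norm_map [OF map_generated_point(1)])
      moreover have "\<bar>norm (\<Phi> (generated_point ?C c)) - norm (generated_point ?Q (g c (Suc k)))\<bar>
          < 1 / 2 ^ Suc k"
        using norm_triangle_ineq3 near by (rule le_less_trans)
      moreover have "1 / 2 ^ Suc k + 1 / 2 ^ Suc k = 1 / (2 :: real) ^ k" by simp
      ultimately show ?thesis using r(2) by (intro exI [of _ r]) linarith
    qed
    with pres show ?thesis unfolding computable_presentation_def by blast
  qed

  show "computable_map ?C ?Q \<Phi>"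
  proof -
    (* Half of the error comes from the name of f, half from evaluating its polynomial. *)
    let ?e = "Comp eg [Comp Query [Comp Succ [Proj 0]], Comp Succ [Proj 0]]"
    have "\<exists>\<sigma>. (\<forall>k. oeval \<rho> ?e [k] (\<sigma> k)) \<and> is_name ?Q (\<Phi> f) \<sigma>"
      if f: "f \<in> cont_funs K" and \<rho>: "is_name ?C f \<rho>" for f \<rho>
    proof (intro exI conjI allI)
      fix k
      have suc: "oeval \<rho> (Comp Succ [Proj 0]) [k] (Suc k)"
        by (rule oeval_Comp [where ys = "[k]"])
          (use oeval_Proj [of 0 "[k]"] oeval_Succ in auto)
      have query: "oeval \<rho> (Comp Query [Comp Succ [Proj 0]]) [k] (\<rho> (Suc k))"
        by (rule oeval_Comp [where ys = "[Suc k]"]) (use suc oeval_Query in auto)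
      show "oeval \<rho> ?e [k] (g (\<rho> (Suc k)) (Suc k))"
        by (rule oeval_Comp [where ys = "[\<rho> (Suc k), Suc k]"])
          (use suc query eg in \<open>auto simp: less_Suc_eq\<close>)
    next
      show "is_name ?Q (\<Phi> f) (\<lambda>k. g (\<rho> (Suc k)) (Suc k))"
        unfolding is_name_def Q
      proof (intro allI conjI g(2))
        fix k
        let ?p = "generated_point ?C (\<rho> (Suc k))"
        have "f - ?p \<in> cont_funs K" using f map_generated_point(1) by (rule cont_funs_closed)
        then have "norm (\<Phi> (f - ?p)) = sup_norm K (f - ?p)" by (rule norm_map)
        moreover have "sup_norm K (f - ?p) < 1 / 2 ^ Suc k"
          using \<rho> unfolding is_name_def C by blast
        ultimately have "norm (\<Phi> (f - ?p)) < 1 / 2 ^ Suc k" by simp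
        then have "norm (\<Phi> f - \<Phi> ?p) < 1 / 2 ^ Suc k"
          using f map_generated_point(1) by (simp add: map_diff)
        moreover note near [of "\<rho> (Suc k)" "Suc k"]
        moreover have "1 / 2 ^ Suc k + 1 / 2 ^ Suc k = 1 / (2 :: real) ^ k" by simp
        ultimately show "norm (\<Phi> f - generated_point ?Q (g (\<rho> (Suc k)) (Suc k))) < 1 / 2 ^ k"
          using norm_diff_triangle_less by metis
      qed
    qed
    then show ?thesis
      unfolding computable_map_def C Q using pres presQ by blast
  qed
qed

end
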